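(* Let $n\ge 2$ and let $f\in W^{1,1}(\mathbb{R}^n)$ be a log-concave function. Then $$ \frac{\Vert f\Vert_{\frac{n}{n-1}}\,|\Pi^*(f)|^{\frac1n}}{\left(\frac{|B_2^n|}{2|B_2^{n-1}|}\right)}\;\geq\;\frac{1}{\exp\left(\dfrac{\int_{\mathbb{R}^n}f(x)\log\left(\frac{f(x)}{\Vert f\Vert_\infty}\right)^{\frac1n}dx}{\int_{\mathbb{R}^n}f(x)\,dx}\right)\Vert f\Vert_\infty^{\frac1n}\left(\dfrac{\int_{\mathbb{R}^n}f(x)\,dx}{\int_{\mathbb{R}^n}f^{\frac{n}{n-1}}(x)\,dx}\right)^{\frac{n-1}{n}}I.rat(f)}. $$
   Context: A function $f:\mathbb{R}^n\to\mathbb{R}$ is log-concave if $f=e^{-v}$ with $v:\mathbb{R}^n\to(-\infty,+\infty]$ convex. Integrable log-concave functions are assumed upper semicontinuous with $\int_{\mathbb{R}^n}f>0$, so that the level sets $\{x: f(x)\ge t\Vert f\Vert_\infty\}$, $t\in(0,1)$, are convex bodies, and the one for $t=1$ is nonempty, compact and convex. $\Vert f\Vert_\infty=\sup f$, $\Vert f\Vert_p$ is the $L^p$ norm, and $0\log 0=0$; $\log(y)^{1/n}$ means $\log(y^{1/n})=\frac1n\log y$. $W^{1,1}(\mathbb{R}^n)=\{f\in L^1(\mathbb{R}^n):\frac{\partial f}{\partial x_i}\in L^1(\mathbb{R}^n)\ \forall i\}$. $B_2^k$ is the closed Euclidean unit ball of $\mathbb{R}^k$ and $|\cdot|$ denotes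 volume. $\Pi^*(f)$, the polar projection body of $f$, is the unit ball of the norm $\Vert x\Vert_{\Pi^*(f)}=\int_{\mathbb{R}^n}|\langle\nabla f(y),x\rangle|\,dy$. An ellipsoid is a set $\mathcal{E}=c+TB_2^n$ with $c\in\mathbb{R}^n$, $T\in GL(n)$; $\mathcal{E}^a=a\chi_{\mathcal{E}}$ for $a>0$. The John's ellipsoid $\mathcal{E}(f)$ of an integrable log-concave function $f$ is the unique function of the form $\mathcal{E}^{a}$ with $\mathcal{E}^a\le f$ pointwise that has the largest integral among all such functions. The integral ratio of $f$ is $$I.rat(f)=\left(\frac{\int_{\mathbb{R}^n}f(x)\,dx}{\int_{\mathbb{R}^n}\mathcal{E}(f)(x)\,dx}\right)^{1/n}.$$ *)

theory Defs
  imports "HOL-Analysis.Analysis"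
begin

definition exp_neg :: "ereal \<Rightarrow> real" where
  "exp_neg u = (if u = \<infinity> then 0 else exp (- real_of_ereal u))"

definition log_concave :: "('a::real_vector \<Rightarrow> real) \<Rightarrow> bool" where
  "log_concave f \<longleftrightarrow>
     (\<exists>v :: 'a \<Rightarrow> ereal.
        (\<forall>x. v x \<noteq> -\<infinity>) \<and>
        (\<forall>x y. \<forall>t\<in>{0..1}.
           v ((1 - t) *\<^sub>R x + t *\<^sub>R y) \<le> ereal (1 - t) * v x + ereal t * v y) \<and>
        (\<forall>x. f x = exp_neg (v x)))"

definition upper_semicontinuous :: "('a::topological_space \<Rightarrow> real) \<Rightarrow> bool" where
  "upper_semicontinuous f \<longleftrightarrow> (\<forall>x. \<forall>c > f x. \<forall>\<^sub>F y in nhds x. f y < c)"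

definition sup_norm :: "('a \<Rightarrow> real) \<Rightarrow> real" where
  "sup_norm f = (SUP x. f x)"

definition Lp_norm :: "real \<Rightarrow> ('a::euclidean_space \<Rightarrow> real) \<Rightarrow> real" where
  "Lp_norm p f = (\<integral>x. \<bar>f x\<bar> powr p \<partial>lborel) powr (1 / p)"

text \<open>The partial derivatives in the Sobolev space are weak derivatives, tested against smooth
  compactly supported functions.\<close>

primrec Ck :: "nat \<Rightarrow> ('a::euclidean_space \<Rightarrow> real) \<Rightarrow> bool" where
  "Ck 0 \<phi> \<longleftrightarrow> continuous_on UNIV \<phi>"
| "Ck (Suc k) \<phi> \<longleftrightarrow>
     \<phi> differentiable_on UNIV \<and> (\<forall>b\<in>Basis. Ck k (\<lambda>x. frechet_derivative \<phi> (at x) b))"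

definition test_fun :: "('a::euclidean_space \<Rightarrow> real) \<Rightarrow> bool" where
  "test_fun \<phi> \<longleftrightarrow> (\<forall>k. Ck k \<phi>) \<and> compact (closure {x. \<phi> x \<noteq> 0})"

definition has_L1_gradient ::
    "('a::euclidean_space \<Rightarrow> real) \<Rightarrow> ('a \<Rightarrow> 'a) \<Rightarrow> bool" where
  "has_L1_gradient f G \<longleftrightarrow>
     integrable lborel G \<and>
     (\<forall>\<phi>. test_fun \<phi> \<longrightarrow>
        (\<forall>b\<in>Basis. (\<integral>x. f x * frechet_derivative \<phi> (at x) b \<partial>lborel)
                    = - (\<integral>x. (G x \<bullet> b) * \<phi> x \<partial>lborel)))"

definition W11 :: "('a::euclidean_space \<Rightarrow> real) set" where
  "W11 = {f. integrable lborel f \<and> (\<exists>G. has_L1_gradient f G)}"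

text \<open>Weak gradients are unique up to null sets, so the representative chosen here does not
  affect the integrals below.\<close>

definition gradient :: "('a::euclidean_space \<Rightarrow> real) \<Rightarrow> 'a \<Rightarrow> 'a" where
  "gradient f = (SOME G. has_L1_gradient f G)"

definition polar_projection_norm :: "('a::euclidean_space \<Rightarrow> real) \<Rightarrow> 'a \<Rightarrow> real" where
  "polar_projection_norm f x = (\<integral>y. \<bar>gradient f y \<bullet> x\<bar> \<partial>lborel)"

definition polar_projection_body :: "('a::euclidean_space \<Rightarrow> real) \<Rightarrow> 'a set" where
  "polar_projection_body f = {x. polar_projection_norm f x \<le> 1}"

definition ellipsoid :: "'a::euclidean_space set \<Rightarrow> bool" where
  "ellipsoid E \<longleftrightarrow> (\<exists>(c::'a) (T::'a \<Rightarrow> 'a). linear T \<and> bij T \<and> E = (\<lambda>x. c + T x) ` cball 0 1)"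

definition ellipsoid_fun :: "('a::euclidean_space \<Rightarrow> real) \<Rightarrow> bool" where
  "ellipsoid_fun g \<longleftrightarrow> (\<exists>E a. ellipsoid E \<and> a > 0 \<and> g = (\<lambda>x. a * indicator E x))"

text \<open>For an integrable log-concave \<open>f\<close> with positive integral the maximizer is unique.\<close>

definition john_ellipsoid :: "('a::euclidean_space \<Rightarrow> real) \<Rightarrow> 'a \<Rightarrow> real" where
  "john_ellipsoid f =
     (ARG_MAX (\<lambda>g. \<integral>x. g x \<partial>lborel) g. ellipsoid_fun g \<and> (\<forall>x. g x \<le> f x))"

definition integral_ratio :: "('a::euclidean_space \<Rightarrow> real) \<Rightarrow> real" where
  "integral_ratio f =
     ((\<integral>x. f x \<partial>lborel) / (\<integral>x. john_ellipsoid f x \<partial>lborel)) powr (1 / real DIM('a))"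

end

theory Submission
  imports Defs
begin

text \<open>
Write \<open>n\<close> for the dimension, \<open>I = \<integral>f\<close>, \<open>M = sup f\<close>, \<open>V\<^sub>k\<close> for the volume of the Euclidean unit ball of
dimension \<open>k\<close>, \<open>G\<close> for the weak gradient of \<open>f\<close>, and let \<open>a \<cdot> 1\<^sub>E\<close>, \<open>E = c + T B\<close>, be the John
ellipsoid of \<open>f\<close>, where \<open>B\<close> is the unit ball.  After cancelling the powers of the \<open>L\<^sup>p\<close> norm the claim says
that the volume of the polar projection body is at least a certain constant; it follows from a lower
bound for that volume and an upper bound for the integral of the gradient, both expressed through
\<open>H = T\<^sup>t G\<close>.

The polar projection body is the image under \<open>T\<close> of \<open>K = {w. N w \<le> 1}\<close> with
\<open>N w = \<integral>\<bar>H \<bullet> w\<bar>\<close>.  Among all sets of the volume of \<open>B\<close>, the dilate of \<open>K\<close> of that volume has the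
smallest integral of \<open>N\<close>; comparing it with \<open>B\<close> bounds the volume of \<open>K\<close> from below by means of
\<open>\<integral>\<^sub>B N\<close> (\<open>measure_norm_ball_ge\<close>).  By Fubini and rotation invariance
\<open>\<integral>\<^sub>B N = (2 V\<^sub>n\<^sub>-\<^sub>1 / (n + 1)) \<integral>\<bar>H\<bar>\<close>, so \<open>\<bar>K\<bar>\<^bsup>1/n\<^esup> \<ge> V\<^sub>n\<^bsup>1/n\<^esup> n V\<^sub>n / (2 V\<^sub>n\<^sub>-\<^sub>1 \<integral>\<bar>H\<bar>)\<close>
(\<open>measure_polar_ball_ge\<close>).

For the integral of the gradient write \<open>f = exp (-v)\<close>.  Convexity puts the tangent of \<open>v\<close> at \<open>y\<close> below
\<open>v\<close>, and \<open>v \<le> - ln a\<close> on \<open>E\<close>; hence \<open>G y \<bullet> (e - y) \<ge> f y ln (a / f y)\<close> for every \<open>e\<close> in \<open>E\<close>.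
The most favourable \<open>e\<close> turns this into \<open>\<bar>H\<bar> \<le> f ln (f / a) - G \<bullet> (y - c)\<close>, and integration by parts
gives \<open>\<integral>\<bar>H\<bar> \<le> n I + \<integral>f ln (f / a)\<close> (\<open>gradient_integral_le\<close>).  Since \<open>f\<close> is only known to be
weakly differentiable, the pointwise inequality is obtained by testing: log-concavity is applied to the
dilations \<open>x \<mapsto> (1 - s) x + s e\<close>, the dilation is moved to the test function by a change of
variables, and \<open>s\<close> tends to 0 (\<open>weak_support_inequality\<close>, \<open>support_inequality_AE\<close>).

The two bounds combine through \<open>1 + x \<le> exp x\<close> (\<open>combine_estimates\<close>).  Of the John
ellipsoid only two properties enter: it is an ellipsoid function and it lies below \<open>f\<close>.  Both rest on
the maximum in its definition being attained, which is a compactness argument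
(\<open>john_ellipsoid_is_arg_max\<close>).
\<close>

section \<open>Linear images of Lebesgue measure\<close>

lemma lborel_integrable_affine:
  fixes h :: "'a::euclidean_space \<Rightarrow> real"
  assumes "integrable lborel h" "c \<noteq> 0"
  shows "integrable lborel (\<lambda>x. h (t + c *\<^sub>R x))"
proof -
  have [measurable]: "h \<in> borel_measurable borel"
    using borel_measurable_integrable[OF assms(1)] by simp
  have "integrable (density (distr lborel borel (\<lambda>x. t + c *\<^sub>R x)) (\<lambda>_. ennreal (\<bar>c\<bar> ^ DIM('a)))) h"
    using assms(1) lborel_affine[OF assms(2), of t] by (metis ennreal_power abs_ge_zero)
  then have "integrable lborel (\<lambda>x. \<bar>c\<bar> ^ DIM('a) *\<^sub>R h (t + c *\<^sub>R x))"
    by (subst (asm) integrable_density) (auto simp: integrable_distr_eq)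
  then show ?thesis using assms(2) by simp
qed

lemma lborel_integral_affine:
  fixes h :: "'a::euclidean_space \<Rightarrow> real"
  assumes [measurable]: "h \<in> borel_measurable borel" and "c \<noteq> 0"
  shows "(\<integral>x. h x \<partial>lborel) = \<bar>c\<bar> ^ DIM('a) * (\<integral>x. h (t + c *\<^sub>R x) \<partial>lborel)"
proof -
  have "(\<integral>x. h x \<partial>lborel) = (\<integral>x. h x \<partial>(density (distr lborel borel (\<lambda>x. t + c *\<^sub>R x)) (\<lambda>_. ennreal (\<bar>c\<bar> ^ DIM('a)))))"
    using lborel_affine[OF assms(2), of t] by (metis ennreal_power abs_ge_zero)
  also have "\<dots> = \<bar>c\<bar> ^ DIM('a) * (\<integral>x. h (t + c *\<^sub>R x) \<partial>lborel)"
    by (subst integral_density) (auto simp: integral_distr)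
  finally show ?thesis .
qed

text \<open>Row operations, and with them the determinant formula for volumes, refer to a well-ordering of the
coordinates. An arbitrary finite index type carries none, so it is replaced by an initial segment of the
natural numbers of the same size.\<close>

typedef (overloaded) ('n::finite) idx = "{..<CARD('n)}"
  by (rule exI[of _ 0]) simp

instantiation idx :: (finite) "{finite, wellorder}"
begin

definition "less_eq_idx (x :: 'a idx) (y :: 'a idx) \<longleftrightarrow> Rep_idx x \<le> Rep_idx y"
definition "less_idx (x :: 'a idx) (y :: 'a idx) \<longleftrightarrow> Rep_idx x < Rep_idx y"

instance
proof
  have "Abs_idx ` {..<CARD('a)} = (UNIV :: 'a idx set)"
    by (rule type_definition.Abs_image[OF type_definition_idx])
  then show "finite (UNIV :: 'a idx set)"
    using finite_imageI[OF finite_lessThan, of Abs_idx "CARD('a)"] by metis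
next
  fix P :: "'a idx \<Rightarrow> bool" and a
  assume step: "\<And>x. (\<And>y. y < x \<Longrightarrow> P y) \<Longrightarrow> P x"
  have "\<forall>b. Rep_idx b = k \<longrightarrow> P b" for k
  proof (induction k rule: less_induct)
    case (less k)
    then show ?case using step unfolding less_idx_def by blast
  qed
  then show "P a" by blast
qed (auto simp: less_eq_idx_def less_idx_def Rep_idx_inject)

end

lemma card_idx: "CARD('n::finite idx) = CARD('n)"
  using type_definition.card[OF type_definition_idx] by simp

text \<open>The witness is the absolute determinant of the matrix reindexed along a bijection with the well-ordered
copy of the index type. Reindexing the coordinates preserves Lebesgue measure, so the determinant formula
carries over. Continuity and positivity serve the maximization over ellipsoids, the scaling law the
change from the polar projection body to the gauge ball.\<close>

lemma exists_vol_factor: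
  "\<exists>d :: real^'n^'n \<Rightarrow> real. continuous_on UNIV d \<and> (\<forall>A. d A \<ge> 0 \<and> (d A > 0 \<longleftrightarrow> bij ((*v) A))) \<and>
     (\<forall>A. \<forall>S\<in>sets borel. emeasure lborel S < \<infinity> \<longrightarrow> (*v) A ` S \<in> sets borel \<longrightarrow>
        emeasure lborel ((*v) A ` S) = ennreal (d A) * emeasure lborel S)"
proof -
  obtain \<sigma> :: "'n idx \<Rightarrow> 'n" where \<sigma>: "bij \<sigma>"
    using finite_same_card_bij[of "UNIV :: 'n idx set" "UNIV :: 'n set"] card_idx[where 'n = 'n] by auto
  then obtain \<tau> where \<tau>\<sigma>: "\<And>i. \<tau> (\<sigma> i) = i" and \<sigma>\<tau>: "\<And>i. \<sigma> (\<tau> i) = i"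
    by (metis bij_inv_eq_iff)
  define h :: "real^'n idx \<Rightarrow> real^'n" where "h x = (\<chi> i. x $ \<tau> i)" for x
  define g :: "real^'n \<Rightarrow> real^'n idx" where "g x = (\<chi> i. x $ \<sigma> i)" for x
  have hg: "h (g x) = x" and gh: "g (h y) = y" for x y
    by (simp_all add: h_def g_def vec_eq_iff \<tau>\<sigma> \<sigma>\<tau>)
  have lin_h: "linear h" and lin_g: "linear g"
    by (auto intro!: linearI simp: h_def g_def vec_eq_iff)
  have [measurable]: "h \<in> borel \<rightarrow>\<^sub>M borel" "g \<in> borel \<rightarrow>\<^sub>M borel"
    by (intro borel_measurable_continuous_onI linear_continuous_on linear_conv_bounded_linear[THEN iffD1] lin_h lin_g)+
  have lborel_g: "distr lborel borel g = lborel"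
  proof (rule lborel_eqI[symmetric])
    fix l u :: "real^'n idx" assume lu: "\<And>b. b \<in> Basis \<Longrightarrow> l \<bullet> b \<le> u \<bullet> b"
    have "emeasure (distr lborel borel g) (box l u) = emeasure lborel (g -` box l u)"
      by (simp add: emeasure_distr)
    also have "g -` box l u = box (h l) (h u)"
      using \<tau>\<sigma> \<sigma>\<tau> by (auto simp: mem_box_cart g_def h_def) (metis \<tau>\<sigma>)+
    also have "emeasure lborel \<dots> = (\<Prod>b\<in>Basis. (h u - h l) \<bullet> b)"
      
    proof (rule emeasure_lborel_box)
      have "l $ i \<le> u $ i" for i using lu[of "axis i 1"] by (auto simp: Basis_vec_def cart_eq_inner_axis)
      then show "h l \<bullet> b \<le> h u \<bullet> b" if "b \<in> Basis" for b
        using that by (auto simp: Basis_vec_def cart_eq_inner_axis[symmetric] h_def)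
    qed
    also have "(\<Prod>b\<in>Basis. (h u - h l) \<bullet> b) = (\<Prod>i\<in>UNIV. (h u - h l) $ i)"
      by (simp add: Basis_vec_def cart_eq_inner_axis prod.UNION_disjoint axis_eq_axis)
    also have "\<dots> = (\<Prod>i\<in>UNIV. (u - l) $ i)"
      by (rule prod.reindex_bij_witness[of _ \<sigma> \<tau>]) (auto simp: \<tau>\<sigma> \<sigma>\<tau> h_def)
    also have "\<dots> = (\<Prod>b\<in>Basis. (u - l) \<bullet> b)"
      by (simp add: Basis_vec_def cart_eq_inner_axis prod.UNION_disjoint axis_eq_axis)
    finally show "emeasure (distr lborel borel g) (box l u) = (\<Prod>b\<in>Basis. (u - l) \<bullet> b)" .
  qed simp
  have em_g: "emeasure lborel X = emeasure lborel (g ` X)" and bor_g: "g ` X \<in> sets borel" 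
    if "X \<in> sets borel" for X
  proof -
    have eq: "g ` X = h -` X" 
    proof (intro equalityI subsetI)
      fix y assume "y \<in> h -` X"
      then show "y \<in> g ` X" using imageI[of "h y" X g] by (simp add: gh)
    qed (auto simp: hg)
    show "g ` X \<in> sets borel" unfolding eq using that measurable_sets[of h borel borel X] by simp
    then have "emeasure (distr lborel borel g) (g ` X) = emeasure lborel (g -` g ` X)"
      by (simp add: emeasure_distr)
    also have "g -` g ` X = X" by (rule inj_vimage_image_eq) (metis hg injI)
    finally show "emeasure lborel X = emeasure lborel (g ` X)" by (simp add: lborel_g)
  qed
  define B :: "real^'n^'n \<Rightarrow> real^'n idx^'n idx" where "B A = (\<chi> i j. A $ \<sigma> i $ \<sigma> j)" for A
  have BA: "B A *v x = g (A *v h x)" for A x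
  proof -
    have "(\<Sum>j\<in>UNIV. A $ \<sigma> i $ \<sigma> j * x $ j) = (\<Sum>j\<in>UNIV. A $ \<sigma> i $ j * x $ \<tau> j)" for i
      by (rule sum.reindex_bij_witness[of _ \<tau> \<sigma>]) (simp_all add: \<tau>\<sigma> \<sigma>\<tau>)
    then show ?thesis
      by (simp add: B_def g_def h_def matrix_vector_mult_def vec_eq_iff)
  qed
  have bijB: "bij ((*v) (B A)) \<longleftrightarrow> bij ((*v) A)" for A
  proof
    have bh: "bij h" "bij g"
      using o_bij[of g h] o_bij[of h g] by (simp_all add: fun_eq_iff hg gh)
    show "bij ((*v) A) \<Longrightarrow> bij ((*v) (B A))"
      using bij_comp[OF bij_comp[OF bh(1)] bh(2), of "(*v) A"] by (simp add: BA[abs_def] comp_def)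
    assume "bij ((*v) (B A))"
    from bij_comp[OF bij_comp[OF bh(2) this] bh(1)] 
    show "bij ((*v) A)" by (simp add: BA comp_def hg)
  qed
  define d where "d A = \<bar>det (B A)\<bar>" for A
  have d_cont: "continuous_on UNIV d"
    unfolding d_def det_def B_def vec_lambda_beta
    by (intro continuous_on_rabs continuous_on_sum continuous_on_mult continuous_on_const
        continuous_on_prod continuous_on_component continuous_on_id)
  have d_nonneg: "d A \<ge> 0" for A by (simp add: d_def)
  have d_pos: "d A > 0 \<longleftrightarrow> bij ((*v) A)" for A
  proof -
    have "d A > 0 \<longleftrightarrow> invertible (B A)" by (simp add: d_def invertible_det_nz)
    also have "\<dots> \<longleftrightarrow> bij ((*v) (B A))" by (simp add: invertible_eq_bij)
    finally show ?thesis using bijB by simp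
  qed
  have d_vol: "emeasure lborel ((*v) A ` S) = d A * emeasure lborel S"
    if S: "S \<in> sets borel" "emeasure lborel S < \<infinity>" and AS: "(*v) A ` S \<in> sets borel" for A S
  proof -
    let ?S = "g ` S"
    have gS: "?S \<in> lmeasurable" "emeasure lborel ?S < \<infinity>"
      using bor_g[OF S(1)] em_g[OF S(1)] S(2) by (auto simp: fmeasurable_def)
    have img: "(*v) (B A) ` ?S = g ` ((*v) A ` S)" by (simp add: BA image_image hg)
    then have bor: "(*v) (B A) ` ?S \<in> sets borel" using bor_g[OF AS] by simp
    have *: "(*v) (B A) ` ?S \<in> lmeasurable" "measure lebesgue ((*v) (B A) ` ?S) = d A * measure lebesgue ?S"
      using measurable_linear_image[OF matrix_vector_mul_linear gS(1)]
       measure_linear_image[OF matrix_vector_mul_linear gS(1), of "B A"] by (simp_all add: d_def)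
    have "emeasure lborel ((*v) A ` S) = emeasure lborel ((*v) (B A) ` ?S)"
      unfolding img by (rule em_g[OF AS])
    also have "\<dots> = emeasure lebesgue ((*v) (B A) ` ?S)" using bor by simp
    also have "\<dots> = ennreal (d A * measure lebesgue ?S)"
      using *  by (metis emeasure_eq_measure2)
    also have "\<dots> = d A * emeasure lebesgue ?S"
      using gS(1) by (simp add: ennreal_mult d_def emeasure_eq_measure2)
    also have "emeasure lebesgue ?S = emeasure lborel S" using bor_g[OF S(1)] em_g[OF S(1)] by simp
    finally show ?thesis .
  qed
  show ?thesis
    by (intro exI[of _ d] conjI allI ballI impI d_cont d_nonneg d_pos d_vol)
qed

text \<open>The absolute determinant, read off from the volume of the image of the unit ball.\<close>

definition vol_factor :: "real^'n^'n \<Rightarrow> real" where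
  "vol_factor A = measure lborel ((*v) A ` cball 0 1) / unit_ball_vol (real CARD('n))"

lemma compact_matrix_image: "compact S \<Longrightarrow> compact ((*v) (A :: real^'n^'m) ` S)"
  by (intro compact_continuous_image linear_continuous_on
      linear_conv_bounded_linear[THEN iffD1] matrix_vector_mul_linear)

lemma vol_factor_characterization:
  "continuous_on UNIV (vol_factor :: real^'n^'n \<Rightarrow> real) \<and>
   (\<forall>A::real^'n^'n. vol_factor A \<ge> 0 \<and> (vol_factor A > 0 \<longleftrightarrow> bij ((*v) A)) \<and>
     (\<forall>S. compact S \<longrightarrow> measure lborel ((*v) A ` S) = vol_factor A * measure lborel S))"
proof -
  obtain d :: "real^'n^'n \<Rightarrow> real" where d: "continuous_on UNIV d" "\<And>A. d A \<ge> 0" "\<And>A. d A > 0 \<longleftrightarrow> bij ((*v) A)"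
    "\<And>A S. S\<in>sets borel \<Longrightarrow> emeasure lborel S < \<infinity> \<Longrightarrow> (*v) A ` S \<in> sets borel \<Longrightarrow>
        emeasure lborel ((*v) A ` S) = ennreal (d A) * emeasure lborel S"
    using exists_vol_factor[where 'n = 'n] by blast
  have m: "measure lborel ((*v) A ` S) = d A * measure lborel S" if S: "compact S" for A S
  proof -
    have "emeasure lborel ((*v) A ` S) = ennreal (d A) * emeasure lborel S"
      using S emeasure_compact_finite[OF S] compact_matrix_image[OF S, of A]
      by (intro d(4)) (auto simp: borel_compact)
    then show ?thesis by (simp add: measure_def enn2real_mult d(2))
  qed
  have V: "unit_ball_vol (real CARD('n)) \<noteq> 0" using unit_ball_vol_pos[of "real CARD('n)"] by linarith
  have "vol_factor A = d A" for A
    using V by (simp add: vol_factor_def m content_cball)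
  then have eq: "vol_factor = d" by (rule ext)
  show ?thesis unfolding eq by (intro conjI allI impI d m)
qed

lemmas continuous_on_vol_factor = vol_factor_characterization[THEN conjunct1]
  and vol_factor_pos_iff = vol_factor_characterization[THEN conjunct2, rule_format, THEN conjunct2, THEN conjunct1]
  and measure_matrix_image = vol_factor_characterization[THEN conjunct2, rule_format, THEN conjunct2, THEN conjunct2, rule_format]

text \<open>The volume factor of an orthogonal map is 1 because the map preserves the unit ball.\<close>

lemma lborel_distr_orthogonal:
  fixes Q :: "real^'n \<Rightarrow> real^'n"
  assumes Q: "orthogonal_transformation Q"
  shows "distr lborel borel Q = lborel"
proof (rule lborel_eqI[symmetric])
  obtain d :: "real^'n^'n \<Rightarrow> real" where
    d: "\<And>A S. S\<in>sets borel \<Longrightarrow> emeasure lborel S < \<infinity> \<Longrightarrow> (*v) A ` S \<in> sets borel \<Longrightarrow>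
        emeasure lborel ((*v) A ` S) = ennreal (d A) * emeasure lborel S"
    using exists_vol_factor[where 'n = 'n] by blast
  define R where "R = inv Q"
  have bijQ: "bij Q" using Q by (rule orthogonal_transformation_bij)
  have R: "orthogonal_transformation R" unfolding R_def using Q by (rule orthogonal_transformation_inv)
  define A where "A = matrix R"
  have A: "(*v) A = R" unfolding A_def
    by (rule ext) (simp add: matrix_works orthogonal_transformation_linear[OF R])
  have Qm [measurable]: "Q \<in> borel \<rightarrow>\<^sub>M borel"
    by (intro borel_measurable_continuous_onI linear_continuous_on linear_conv_bounded_linear[THEN iffD1]
      orthogonal_transformation_linear[OF Q])
  have RQ: "R ` X = Q -` X" for X unfolding R_def using bij_vimage_eq_inv_image[OF bijQ] by simp
  have bor: "R ` X \<in> sets borel" if "X \<in> sets borel" for X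
    unfolding RQ using measurable_sets[OF Qm that] by simp
  have ball: "R ` cball 0 1 = cball 0 1"
    unfolding RQ using Q by (auto simp: orthogonal_transformation_norm)
  define c where "c = unit_ball_vol (real CARD('n))"
  have c: "c > 0" by (simp add: c_def)
  have emb: "emeasure lborel (cball 0 1 :: (real^'n) set) = ennreal c" by (simp add: emeasure_cball c_def)
  have "ennreal c = ennreal (d A) * ennreal c"
    using d[of "cball 0 1" A] unfolding A ball emb by simp
  then have dA: "ennreal (d A) = 1" using c
    by (cases "d A \<ge> 0") (auto simp: ennreal_neg simp flip: ennreal_mult)
  fix l u :: "real^'n" assume lu: "\<And>b. b \<in> Basis \<Longrightarrow> l \<bullet> b \<le> u \<bullet> b"
  have "emeasure (distr lborel borel Q) (box l u) = emeasure lborel (R ` box l u)"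
    by (simp add: emeasure_distr RQ)
  also have "\<dots> = emeasure lborel (box l u)"
    using d[of "box l u" A] bor[of "box l u"] unfolding A using emeasure_bounded_finite[OF bounded_box, of l u] by (simp add: dA)
  also have "\<dots> = (\<Prod>b\<in>Basis. (u - l) \<bullet> b)" using lu by (rule emeasure_lborel_box)
  finally show "emeasure (distr lborel borel Q) (box l u) = (\<Prod>b\<in>Basis. (u - l) \<bullet> b)" .
qed simp

section \<open>The volume of a gauge ball\<close>

text \<open>The primitive of \<open>y (1 - y\<^sup>2)\<^bsup>m/2\<^esup>\<close> is explicit; differentiability fails at \<open>\<plusminus>1\<close>, so the fundamental theorem
is used in the form that asks for continuity at the end points only.\<close>

lemma abs_times_sqrt_power_integral:
  "(\<integral>\<^sup>+y. ennreal (\<bar>y\<bar> * sqrt (1 - y\<^sup>2) ^ m * indicator {-1..1} y) \<partial>lborel) = ennreal (2 / (real m + 2))"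
proof -
  let ?g = "\<lambda>y::real. \<bar>y\<bar> * sqrt (1 - y\<^sup>2) ^ m"
  let ?F = "\<lambda>y::real. sqrt (1 - y\<^sup>2) ^ (m + 2) / (real m + 2)"
  have cont: "continuous_on S ?F" for S by (intro continuous_intros) auto
  have der: "(?F has_real_derivative - y * sqrt (1 - y\<^sup>2) ^ m) (at y)" if "-1 < y" "y < 1" for y
  proof -
    have pos: "1 - y\<^sup>2 > 0" using that by (simp add: abs_square_less_1)
    have "((\<lambda>y. sqrt (1 - y\<^sup>2)) has_real_derivative (- 2 * y) * (inverse (sqrt (1 - y\<^sup>2)) / 2)) (at y)"
      using pos by (auto intro!: derivative_eq_intros)
    from DERIV_cdivide[OF DERIV_power[OF this, of "m + 2"], of "real m + 2"]
    have "(?F has_real_derivative real (m + 2) * ((- 2 * y) * (inverse (sqrt (1 - y\<^sup>2)) / 2) * sqrt (1 - y\<^sup>2) ^ (m + 1)) / (real m + 2)) (at y)"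
      by simp
    also have "real (m + 2) * ((- 2 * y) * (inverse (sqrt (1 - y\<^sup>2)) / 2) * sqrt (1 - y\<^sup>2) ^ (m + 1)) / (real m + 2)
        = (- 2 * y) * (inverse (sqrt (1 - y\<^sup>2)) / 2) * sqrt (1 - y\<^sup>2) ^ (m + 1)" by (simp add: add.commute[of 2])
    also have "\<dots> = - y * sqrt (1 - y\<^sup>2) ^ m" using pos by (simp add: field_simps)
    finally show ?thesis .
  qed
  have "((\<lambda>y. - ?g y) has_integral ?F 1 - ?F 0) {0..1}"
    using der by (intro fundamental_theorem_of_calculus_interior cont)
      (auto simp flip: has_real_derivative_iff_has_vector_derivative)
  then have 1: "(?g has_integral 1 / (real m + 2)) {0..1}" by (auto dest: has_integral_neg)
  have "(?g has_integral ?F 0 - ?F (-1)) {-1..0}"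
    using der by (intro fundamental_theorem_of_calculus_interior cont)
      (auto simp flip: has_real_derivative_iff_has_vector_derivative)
  then have "(?g has_integral 1 / (real m + 2)) {-1..0}" by simp
  from has_integral_combine[OF _ _ this 1]
  have "(?g has_integral 2 / (real m + 2)) {-1..1}" by simp
  then have "integral\<^sup>N lborel (\<lambda>x. ennreal (indicator {-1..1} x * ?g x)) = ennreal (2 / (real m + 2))"
    by (intro nn_integral_has_integral_lebesgue) (auto simp: abs_square_le_1)
  then show ?thesis by (simp add: mult.commute)
qed

text \<open>Slicing the unit ball orthogonally to \<open>b\<close> at height \<open>y\<close> gives a ball of radius \<open>sqrt (1 - y\<^sup>2)\<close> in one
dimension less, so the integral is \<open>V\<^sub>n\<^sub>-\<^sub>1\<close> times a one-dimensional one.\<close>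

lemma integral_abs_inner_Basis_cball:
  fixes b :: "'a::euclidean_space"
  assumes b: "b \<in> Basis"
  shows "(\<integral>\<^sup>+w. ennreal (\<bar>w \<bullet> b\<bar> * indicator (cball 0 1) w) \<partial>lborel)
    = ennreal (2 * unit_ball_vol (real DIM('a) - 1) / (real DIM('a) + 1))"
proof -
  interpret product_sigma_finite "\<lambda>_. lborel" by standard
  define A where "A = (Basis :: 'a set) - {b}"
  have BA: "Basis = insert b A" "b \<notin> A" "finite A" using b by (auto simp: A_def)
  have cA: "real (card A) = real DIM('a) - 1" using b
    by (simp add: A_def of_nat_diff DIM_positive Suc_leI)
  let ?e = "\<lambda>f. \<Sum>b\<in>Basis. f b *\<^sub>R b :: 'a"
  have [measurable]: "cball (0::'a) 1 \<in> sets borel" by simp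
  let ?N = "\<lambda>f. sqrt (\<Sum>i\<in>Basis. (f i)\<^sup>2)"
  have "(\<integral>\<^sup>+w. ennreal (\<bar>w \<bullet> b\<bar> * indicator (cball 0 1) w) \<partial>lborel) 
    = (\<integral>\<^sup>+f. ennreal (\<bar>?e f \<bullet> b\<bar> * indicator (cball 0 1) (?e f)) \<partial>Pi\<^sub>M Basis (\<lambda>_. lborel))"
    by (subst lborel_eq, subst nn_integral_distr) measurable
  also have "\<dots> = (\<integral>\<^sup>+f. ennreal (\<bar>f b\<bar> * of_bool (?N f \<le> 1)) \<partial>Pi\<^sub>M Basis (\<lambda>_. lborel))"
  proof (rule nn_integral_cong)
    fix f :: "'a \<Rightarrow> real"
    have "?e f \<bullet> b = f b" using b by simp
    moreover have "norm (?e f) = ?N f"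
      using euclidean_dist_l2[of 0 "?e f"] by (simp add: L2_set_def)
    ultimately show "ennreal (\<bar>?e f \<bullet> b\<bar> * indicator (cball 0 1) (?e f)) = ennreal (\<bar>f b\<bar> * of_bool (?N f \<le> 1))"
      by (simp add: indicator_def)
  qed
  also have "\<dots> = (\<integral>\<^sup>+ y. \<integral>\<^sup>+ x. ennreal (\<bar>(x(b := y)) b\<bar> * of_bool (?N (x(b := y)) \<le> 1))
                   \<partial>Pi\<^sub>M A (\<lambda>_. lborel) \<partial>lborel)"
    unfolding BA(1) using BA(2,3) by (intro product_nn_integral_insert_rev) measurable
  also have "\<dots> = (\<integral>\<^sup>+ y. ennreal (\<bar>y\<bar> * sqrt (1 - y\<^sup>2) ^ card A * indicator {-1..1} y) * unit_ball_vol (card A) \<partial>lborel)"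
  proof (rule nn_integral_cong_AE)
    have "AE y in lborel. y \<notin> {-1, 1::real}"
      by (intro AE_not_in countable_imp_null_set_lborel) auto
    then show "AE y in lborel. (\<integral>\<^sup>+ x. ennreal (\<bar>(x(b := y)) b\<bar> * of_bool (?N (x(b := y)) \<le> 1)) \<partial>Pi\<^sub>M A (\<lambda>_. lborel))
      = ennreal (\<bar>y\<bar> * sqrt (1 - y\<^sup>2) ^ card A * indicator {-1..1} y) * unit_ball_vol (card A)"
    proof eventually_elim
      case (elim y)
      have sum: "(\<Sum>i\<in>Basis. ((x(b := y)) i)\<^sup>2) = y\<^sup>2 + (\<Sum>i\<in>A. (x i)\<^sup>2)" for x :: "'a \<Rightarrow> real"
      proof -
        have "(\<Sum>i\<in>A. ((x(b := y)) i)\<^sup>2) = (\<Sum>i\<in>A. (x i)\<^sup>2)" using BA(2) by (intro sum.cong) auto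
        then show ?thesis unfolding BA(1) using BA(2,3) by simp
      qed
      have s0: "(\<Sum>i\<in>A. (x i)\<^sup>2) \<ge> 0" for x :: "'a \<Rightarrow> real" by (intro sum_nonneg) auto
      show ?case
      proof (cases "\<bar>y\<bar> < 1")
        case True
        then have y: "1 - y\<^sup>2 > 0" by (simp add: abs_square_less_1)
        let ?S = "{f. sqrt (\<Sum>i\<in>A. (f i)\<^sup>2) \<le> sqrt (1 - y\<^sup>2)} \<inter> space (Pi\<^sub>M A (\<lambda>_. lborel))"
        have "(\<integral>\<^sup>+ x. ennreal (\<bar>(x(b := y)) b\<bar> * of_bool (?N (x(b := y)) \<le> 1)) \<partial>Pi\<^sub>M A (\<lambda>_. lborel))
          = (\<integral>\<^sup>+ x. ennreal \<bar>y\<bar> * indicator ?S x \<partial>Pi\<^sub>M A (\<lambda>_. lborel))"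
          unfolding sum by (intro nn_integral_cong) (auto simp: indicator_def of_bool_def algebra_simps)
        also have "\<dots> = ennreal \<bar>y\<bar> * emeasure (Pi\<^sub>M A (\<lambda>_. lborel)) ?S"
          by (intro nn_integral_cmult_indicator) auto
        also have "\<dots> = ennreal \<bar>y\<bar> * ennreal (unit_ball_vol (card A) * sqrt (1 - y\<^sup>2) ^ card A)"
          using y BA(3) by (subst emeasure_cball_aux) auto
        also have "\<dots> = ennreal (\<bar>y\<bar> * sqrt (1 - y\<^sup>2) ^ card A * indicator {-1..1} y) * unit_ball_vol (card A)"
          using y True by (auto simp: indicator_def mult_ac simp flip: ennreal_mult)
        finally show ?thesis .
      next
        case False
        then have "1 < \<bar>y\<bar>" using elim by auto
        then have "1 < \<bar>y\<bar>\<^sup>2" by (rule one_less_power) simp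
        then have "1 < y\<^sup>2" by simp
        then have "\<not> ?N (x(b := y)) \<le> 1" for x using s0[of x] unfolding sum by simp
        then show ?thesis using False elim by (auto simp: indicator_def)
      qed
    qed
  qed
  also have "\<dots> = ennreal (2 / (real (card A) + 2)) * unit_ball_vol (card A)"
    by (subst nn_integral_multc) (auto simp: abs_times_sqrt_power_integral)
  also have "\<dots> = ennreal (2 * unit_ball_vol (real DIM('a) - 1) / (real DIM('a) + 1))"
    unfolding cA using cA by (subst ennreal_mult[symmetric]) auto
  finally show ?thesis .
qed

text \<open>By rotation invariance \<open>h\<close> may be replaced by a multiple of a coordinate vector.\<close>

lemma nn_integral_abs_inner_cball:
  fixes h :: "real^'n"
  shows "(\<integral>\<^sup>+w. ennreal (\<bar>h \<bullet> w\<bar> * indicator (cball 0 1) w) \<partial>lborel)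
    = ennreal (norm h * (2 * unit_ball_vol (real CARD('n) - 1) / (real CARD('n) + 1)))"
proof -
  define e :: "real^'n" where "e = axis (SOME k. True) 1"
  have e: "norm e = 1" "e \<in> Basis" by (simp_all add: e_def norm_axis_1)
  define c where "c = 2 * unit_ball_vol (real CARD('n) - 1) / (real CARD('n) + 1)"
  have c0: "c \<ge> 0" unfolding c_def by simp
  have [measurable]: "cball (0::real^'n) 1 \<in> sets borel" by simp
  obtain Q :: "real^'n \<Rightarrow> real^'n" where Q: "orthogonal_transformation Q" "Q (norm h *\<^sub>R e) = h"
  proof -
    have "norm (norm h *\<^sub>R e) = norm h" by (simp add: e)
    then show thesis by (rule orthogonal_transformation_exists) (erule (1) that)
  qed
  have Qm [measurable]: "Q \<in> borel \<rightarrow>\<^sub>M borel"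
    by (intro borel_measurable_continuous_onI linear_continuous_on linear_conv_bounded_linear[THEN iffD1]
      orthogonal_transformation_linear[OF Q(1)])
  have "(\<integral>\<^sup>+w. ennreal (\<bar>h \<bullet> w\<bar> * indicator (cball 0 1) w) \<partial>lborel)
    = (\<integral>\<^sup>+w. ennreal (\<bar>h \<bullet> w\<bar> * indicator (cball 0 1) w) \<partial>(distr lborel borel Q))"
    by (simp add: lborel_distr_orthogonal[OF Q(1)])
  also have "\<dots> = (\<integral>\<^sup>+w. ennreal (\<bar>h \<bullet> Q w\<bar> * indicator (cball 0 1) (Q w)) \<partial>lborel)"
    by (subst nn_integral_distr) measurable
  also have "\<dots> = (\<integral>\<^sup>+w. ennreal (norm h) * ennreal (\<bar>w \<bullet> e\<bar> * indicator (cball 0 1) w) \<partial>lborel)"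
  proof (rule nn_integral_cong)
    fix w :: "real^'n"
    have "h \<bullet> Q w = Q (norm h *\<^sub>R e) \<bullet> Q w" by (simp only: Q(2))
    also have "\<dots> = (norm h *\<^sub>R e) \<bullet> w" using Q(1) by (simp add: orthogonal_transformation_def)
    finally have "h \<bullet> Q w = norm h * (w \<bullet> e)" by (simp add: inner_commute)
    then show "ennreal (\<bar>h \<bullet> Q w\<bar> * indicator (cball 0 1) (Q w)) = ennreal (norm h) * ennreal (\<bar>w \<bullet> e\<bar> * indicator (cball 0 1) w)"
      using Q(1) by (simp add: orthogonal_transformation_norm abs_mult indicator_def mult.assoc flip: ennreal_mult)
  qed
  also have "\<dots> = ennreal (norm h) * ennreal c"
    unfolding c_def using integral_abs_inner_Basis_cball[of e]
    by (subst nn_integral_cmult) (measurable, simp add: e)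
  also have "\<dots> = ennreal (norm h * c)" using c0 by (simp add: ennreal_mult)
  finally show ?thesis unfolding c_def .
qed

lemma measure_gauge_sublevel:
  fixes N :: "'a::euclidean_space \<Rightarrow> real"
  assumes cont: "continuous_on UNIV N" and hom: "\<And>c w. c > 0 \<Longrightarrow> N (c *\<^sub>R w) = c * N w" and s: "s > 0"
  shows "emeasure lborel {w. N w \<le> s} = ennreal (s ^ DIM('a)) * emeasure lborel {w. N w \<le> 1}"
proof -
  have cl: "closed {w. N w \<le> t}" for t
    using continuous_closed_preimage[OF cont closed_UNIV closed_atMost, of t] by (simp add: vimage_def)
  have eq: "{w. N w \<le> s} = (\<lambda>x. s *\<^sub>R x + 0) ` {w. N w \<le> 1}"
  proof (intro equalityI subsetI)
    fix w assume "w \<in> {w. N w \<le> s}"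
    then have "(1 / s) *\<^sub>R w \<in> {w. N w \<le> 1}" using hom[of "1 / s" w] s by simp
    moreover have "w = s *\<^sub>R ((1 / s) *\<^sub>R w) + 0" using s by simp
    ultimately show "w \<in> (\<lambda>x. s *\<^sub>R x + 0) ` {w. N w \<le> 1}" by (rule rev_image_eqI)
  qed (use s hom in auto)
  have "emeasure lborel {w. N w \<le> s} = emeasure lebesgue {w. N w \<le> s}" using cl by simp
  also have "\<dots> = \<bar>s\<bar> ^ DIM('a) * emeasure lebesgue {w. N w \<le> 1}"
    unfolding eq by (rule emeasure_lebesgue_affine)
  finally show ?thesis using s cl by simp
qed

text \<open>The Lagrangian form of the bathtub principle: \<open>N \<ge> l - max 0 (l - N)\<close> on the ball, and the integral of
\<open>max 0 (l - N)\<close> over the whole space is computed by integrating the volumes of the sublevel sets of \<open>N\<close>.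
The free parameter \<open>l\<close> replaces the choice of a dilate of the gauge ball.\<close>

lemma integral_norm_ge:
  fixes N :: "'a::euclidean_space \<Rightarrow> real"
  assumes cont: "continuous_on UNIV N" and hom: "\<And>c w. c > 0 \<Longrightarrow> N (c *\<^sub>R w) = c * N w"
    and nonneg: "\<And>w. N w \<ge> 0" and fin: "bounded {w. N w \<le> 1}" and l: "l > 0"
  shows "(\<integral>w. N w * indicator (cball 0 1) w \<partial>lborel)
    \<ge> l * unit_ball_vol DIM('a) - l ^ (DIM('a) + 1) * measure lborel {w. N w \<le> 1} / (DIM('a) + 1)"
proof -
  let ?K = "{w. N w \<le> 1}" and ?B = "cball (0::'a) 1" and ?n = "DIM('a)"
  have [measurable]: "N \<in> borel_measurable borel" using cont by (rule borel_measurable_continuous_onI)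
  have [measurable]: "?B \<in> sets borel" by simp
  have K: "emeasure lborel ?K = ennreal (measure lborel ?K)"
    using emeasure_bounded_finite[OF fin] by (intro emeasure_eq_ennreal_measure) auto
  have layer: "ennreal (max 0 (l - N w)) = (\<integral>\<^sup>+s. indicator {0..l} s * indicator {w. N w \<le> s} w \<partial>lborel)" for w
  proof -
    have "(\<integral>\<^sup>+s. indicator {0..l} s * indicator {w. N w \<le> s} w \<partial>lborel) = (\<integral>\<^sup>+s. indicator {N w..l} s \<partial>lborel)"
      using nonneg[of w] by (intro nn_integral_cong) (auto simp: indicator_def)
    also have "\<dots> = ennreal (max 0 (l - N w))" by (cases "N w \<le> l") (auto simp: max_def)
    finally show ?thesis ..
  qed
  have "(\<integral>\<^sup>+w. ennreal (max 0 (l - N w)) \<partial>lborel)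
    = (\<integral>\<^sup>+s. (\<integral>\<^sup>+w. indicator {0..l} s * indicator {w. N w \<le> s} w \<partial>lborel) \<partial>lborel)"
    unfolding layer by (rule lborel_pair.Fubini') (simp add: indicator_def split_beta', measurable)
  also have "\<dots> = (\<integral>\<^sup>+s. ennreal (s ^ ?n) * ennreal (measure lborel ?K) * indicator {0..l} s \<partial>lborel)"
  proof (rule nn_integral_cong_AE)
    have "AE s in lborel. s \<noteq> (0::real)" by (rule AE_lborel_singleton)
    then show "AE s in lborel. (\<integral>\<^sup>+w. indicator {0..l} s * indicator {w. N w \<le> s} w \<partial>lborel)
        = ennreal (s ^ ?n) * ennreal (measure lborel ?K) * indicator {0..l} s"
    proof eventually_elim
      case (elim s)
      have "(\<integral>\<^sup>+w. indicator {0..l} s * indicator {w. N w \<le> s} w \<partial>lborel) = indicator {0..l} s * emeasure lborel {w. N w \<le> s}"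
        by (simp add: nn_integral_cmult_indicator)
      then show ?case using elim measure_gauge_sublevel[OF cont hom, of s]
        by (auto simp: indicator_def K)
    qed
  qed
  also have "\<dots> = (\<integral>\<^sup>+s. ennreal (measure lborel ?K) * (ennreal (s ^ ?n) * indicator {0..l} s) \<partial>lborel)"
    by (simp add: mult_ac)
  also have "\<dots> = ennreal (measure lborel ?K) * (\<integral>\<^sup>+s. ennreal (s ^ ?n) * indicator {0..l} s \<partial>lborel)"
    by (subst nn_integral_cmult) auto
  also have "(\<integral>\<^sup>+s. ennreal (s ^ ?n) * indicator {0..l} s \<partial>lborel) = ennreal (l ^ Suc ?n / Suc ?n - 0 ^ Suc ?n / Suc ?n)"
    using l by (intro nn_integral_FTC_Icc[where F = "\<lambda>s. s ^ Suc ?n / Suc ?n"])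
      (auto intro!: derivative_eq_intros simp del: power_Suc)
  finally have *: "(\<integral>\<^sup>+w. ennreal (max 0 (l - N w)) \<partial>lborel) = ennreal (l ^ (?n + 1) * measure lborel ?K / (?n + 1))"
    using l by (simp add: mult.commute flip: ennreal_mult')
  then have int1: "integrable lborel (\<lambda>w. max 0 (l - N w))"
    by (intro integrableI_nonneg) auto
  have I1: "(\<integral>w. max 0 (l - N w) \<partial>lborel) = l ^ (?n + 1) * measure lborel ?K / (?n + 1)"
    using * l by (subst integral_eq_nn_integral) auto
  have intN: "integrable lborel (\<lambda>w. N w * indicator ?B w)"
    using borel_integrable_compact[OF compact_cball continuous_on_subset[OF cont], of 0 1]
    by (simp add: mult.commute)
  have intB: "integrable lborel (\<lambda>w. indicator ?B w :: real)"
    using emeasure_bounded_finite[OF bounded_cball] by (intro integrable_real_indicator) auto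
  have "l * unit_ball_vol ?n - l ^ (?n + 1) * measure lborel ?K / (?n + 1)
    = (\<integral>w. l * indicator ?B w - max 0 (l - N w) \<partial>lborel)"
    using int1 intB by (simp add: I1 content_cball)
  also have "\<dots> \<le> (\<integral>w. N w * indicator ?B w \<partial>lborel)"
    using int1 intB intN by (intro integral_mono) (auto simp: indicator_def)
  finally show ?thesis by (simp add: add.commute)
qed

text \<open>The parameter of the preceding inequality is chosen so that the \<open>l\<close>-dilate of the gauge ball has the volume
of the Euclidean unit ball.\<close>

lemma measure_norm_ball_ge:
  fixes N :: "'a::euclidean_space \<Rightarrow> real" and A :: real
  assumes cont: "continuous_on UNIV N" and hom: "\<And>c w. c > 0 \<Longrightarrow> N (c *\<^sub>R w) = c * N w"
    and nonneg: "\<And>w. N w \<ge> 0" and zero: "N 0 = 0" and fin: "bounded {w. N w \<le> 1}"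
    and A: "A = (\<integral>w. N w * indicator (cball 0 1) w \<partial>lborel)" "A > 0"
  shows "measure lborel {w. N w \<le> 1} powr (1 / DIM('a))
    \<ge> unit_ball_vol DIM('a) powr (1 / DIM('a)) * (DIM('a) * unit_ball_vol DIM('a) / ((DIM('a) + 1) * A))"
proof -
  define n where "n = DIM('a)"
  define V where "V = unit_ball_vol (real n)"
  define k where "k = measure lborel {w. N w \<le> 1}"
  have n: "n > 0" by (simp add: n_def)
  have V: "V > 0" by (simp add: V_def)
  have k: "k > 0"
  proof -
    have "open {w. N w < 1}"
      using continuous_open_preimage[OF cont open_UNIV open_lessThan, of 1] by (simp add: vimage_def)
    then have "\<exists>e>0. ball 0 e \<subseteq> {w. N w < 1}"
      unfolding open_contains_ball using zero by (metis (mono_tags) mem_Collect_eq zero_less_one)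
    then obtain e where e: "e > 0" "ball 0 e \<subseteq> {w. N w < 1}" by blast
    have "0 < measure lborel (ball (0::'a) e)" using e(1) by (simp add: content_ball)
    also have "\<dots> \<le> k" unfolding k_def
    proof (rule measure_mono_fmeasurable)
      show "ball 0 e \<subseteq> {w. N w \<le> 1}" using e(2) by auto
      have "closed {w. N w \<le> 1}"
        using continuous_closed_preimage[OF cont closed_UNIV closed_atMost, of 1] by (simp add: vimage_def)
      then show "{w. N w \<le> 1} \<in> fmeasurable lborel"
        using emeasure_bounded_finite[OF fin] by (simp add: fmeasurable_def)
    qed simp
    finally show ?thesis .
  qed
  define l where "l = (V / k) powr (1 / n)"
  have l: "l > 0" using V k by (simp add: l_def)
  have ln: "l ^ n = V / k" using V k n unfolding l_def by (simp add: powr_realpow[symmetric] powr_powr)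
  have "l * V - l ^ (n + 1) * k / (n + 1) \<le> A"
    unfolding A V_def k_def n_def using integral_norm_ge[OF cont hom nonneg fin l] by simp
  moreover have "l ^ (n + 1) * k = l * V" using k ln by simp
  ultimately have "l * V - l * V / (n + 1) \<le> A" by (simp only:)
  then have "l * V * n \<le> (n + 1) * A" using n by (simp add: field_simps)
  then have "n * V \<le> 1 / l * ((n + 1) * A)" using l by (simp add: pos_le_divide_eq mult_ac)
  moreover have "(n + 1) * A > 0" using A(2) by simp
  ultimately have le: "n * V / ((n + 1) * A) \<le> 1 / l" by (simp only: pos_divide_le_eq)
  have "V powr (1 / n) * (n * V / ((n + 1) * A)) \<le> V powr (1 / n) * (1 / l)"
    using le by (intro mult_left_mono) auto
  also have "\<dots> = k powr (1 / n)" using V k unfolding l_def by (simp add: powr_divide)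
  finally show ?thesis unfolding V_def k_def n_def by (simp add: add.commute)
qed

text \<open>The gauge \<open>N w = \<integral>\<bar>H \<bullet> w\<bar>\<close> is Lipschitz with constant \<open>\<integral>\<bar>H\<bar>\<close> and positive on the unit sphere, which makes its
unit ball compact. Fubini evaluates its integral over the Euclidean ball.\<close>

lemma measure_polar_ball_ge:
  fixes H :: "'b::euclidean_space \<Rightarrow> real^'n"
  assumes H: "integrable lborel H"
    and pos: "\<And>w. w \<noteq> 0 \<Longrightarrow> (\<integral>y. \<bar>H y \<bullet> w\<bar> \<partial>lborel) > 0"
  defines "K \<equiv> {w. (\<integral>y. \<bar>H y \<bullet> w\<bar> \<partial>lborel) \<le> 1}" and "n \<equiv> real CARD('n)"
  shows "bounded K" "closed K"
    "measure lborel K powr (1 / n) * (2 * unit_ball_vol (n - 1) * (\<integral>y. norm (H y) \<partial>lborel))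
      \<ge> unit_ball_vol n powr (1 / n) * (n * unit_ball_vol n)"
proof -
  define N where "N w = (\<integral>y. \<bar>H y \<bullet> w\<bar> \<partial>lborel)" for w
  define h where "h = (\<integral>y. norm (H y) \<partial>lborel)"
  have [measurable]: "H \<in> borel_measurable borel" using H by (simp add: borel_measurable_integrable)
  have K: "K = {w. N w \<le> 1}" by (simp add: K_def N_def)
  have int: "integrable lborel (\<lambda>y. \<bar>H y \<bullet> w\<bar>)" for w
    using H by (intro integrable_abs integrable_inner_left)
  have inth: "integrable lborel (\<lambda>y. norm (H y))" using H by (rule integrable_norm)
  have h0: "h \<ge> 0" by (simp add: h_def)
  have N0: "N w \<ge> 0" for w by (simp add: N_def)
  have Nzero: "N 0 = 0" by (simp add: N_def)
  have hom: "N (c *\<^sub>R w) = c * N w" if "c > 0" for c w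
    using that by (simp add: N_def abs_mult)
  have lip: "\<bar>N v - N w\<bar> \<le> h * norm (v - w)" for v w
  proof -
    have "N v - N w = (\<integral>y. \<bar>H y \<bullet> v\<bar> - \<bar>H y \<bullet> w\<bar> \<partial>lborel)"
      unfolding N_def by (intro Bochner_Integration.integral_diff[symmetric] int)
    also have "\<bar>\<dots>\<bar> \<le> (\<integral>y. \<bar>\<bar>H y \<bullet> v\<bar> - \<bar>H y \<bullet> w\<bar>\<bar> \<partial>lborel)" by (rule integral_abs_bound)
    also have "\<dots> \<le> (\<integral>y. norm (H y) * norm (v - w) \<partial>lborel)"
    proof (intro integral_mono integrable_abs[OF Bochner_Integration.integrable_diff[OF int int]] integrable_mult_left inth)
      fix y
      have "\<bar>\<bar>H y \<bullet> v\<bar> - \<bar>H y \<bullet> w\<bar>\<bar> \<le> \<bar>H y \<bullet> (v - w)\<bar>" by (simp add: inner_diff_right)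
      also have "\<dots> \<le> norm (H y) * norm (v - w)" by (rule Cauchy_Schwarz_ineq2)
      finally show "\<bar>\<bar>H y \<bullet> v\<bar> - \<bar>H y \<bullet> w\<bar>\<bar> \<le> norm (H y) * norm (v - w)" .
    qed
    also have "\<dots> = h * norm (v - w)" by (simp add: h_def)
    finally show ?thesis .
  qed
  have cont: "continuous_on UNIV N"
    unfolding continuous_on_iff
  proof (intro ballI allI impI)
    fix x :: "real^'n" and e :: real assume e: "e > 0"
    have "dist (N x') (N x) < e" if "dist x' x < e / (h + 1)" for x'
    proof -
      have "h * norm (x' - x) \<le> (h + 1) * norm (x' - x)" by (intro mult_right_mono) auto
      also have "\<dots> < e" using that h0 by (simp add: dist_norm field_simps)
      finally show ?thesis using lip[of x' x] by (simp add: dist_real_def)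
    qed
    then show "\<exists>d>0. \<forall>x'\<in>UNIV. dist x' x < d \<longrightarrow> dist (N x') (N x) < e"
      using e h0 by (intro exI[of _ "e / (h + 1)"]) auto
  qed
  show "closed K"
    using continuous_closed_preimage[OF cont closed_UNIV closed_atMost, of 1] by (simp add: vimage_def K)
  have "\<exists>x\<in>sphere 0 1. \<forall>y\<in>sphere (0::real^'n) 1. N x \<le> N y"
    by (intro continuous_attains_inf continuous_on_subset[OF cont]) auto
  then obtain u where u: "norm u = 1" "\<And>y. norm y = 1 \<Longrightarrow> N u \<le> N y" by auto
  have "u \<noteq> 0" using u(1) by auto
  then have Nu: "N u > 0" unfolding N_def by (rule pos)
  have "norm w \<le> 1 / N u" if "N w \<le> 1" for w
  proof (cases "w = 0")
    case False
    have "N u \<le> N ((1 / norm w) *\<^sub>R w)" using False by (intro u(2)) simp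
    also have "\<dots> = N w / norm w" using False by (subst hom) auto
    finally have "N u * norm w \<le> 1" using that False by (simp add: field_simps)
    then show ?thesis using Nu by (simp add: field_simps)
  qed (use Nu in simp)
  then have "K \<subseteq> cball 0 (1 / N u)" by (auto simp: K)
  then show bK: "bounded K" using bounded_cball bounded_subset by blast
  define A where "A = (\<integral>w. N w * indicator (cball 0 1) w \<partial>lborel)"
  have [measurable]: "cball (0::real^'n) 1 \<in> sets borel" by simp
  have [measurable]: "N \<in> borel_measurable borel" using cont by (rule borel_measurable_continuous_onI)
  define c where "c = 2 * unit_ball_vol (n - 1) / (n + 1)"
  have c0: "c > 0" unfolding c_def n_def by simp
  have "ennreal A = (\<integral>\<^sup>+w. ennreal (N w * indicator (cball 0 1) w) \<partial>lborel)"
  proof -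
    have "integrable lborel (\<lambda>w. N w * indicator (cball 0 1) w)"
      using borel_integrable_compact[OF compact_cball continuous_on_subset[OF cont], of 0 1]
      by (simp add: mult.commute)
    then show ?thesis unfolding A_def by (intro nn_integral_eq_integral[symmetric]) (auto simp: N0)
  qed
  also have "\<dots> = (\<integral>\<^sup>+w. (\<integral>\<^sup>+y. ennreal (\<bar>H y \<bullet> w\<bar> * indicator (cball 0 1) w) \<partial>lborel) \<partial>lborel)"
  proof (rule nn_integral_cong)
    fix w :: "real^'n"
    have "ennreal (N w * indicator (cball 0 1) w) = ennreal (\<integral>y. \<bar>H y \<bullet> w\<bar> * indicator (cball 0 1) w \<partial>lborel)"
      by (simp add: N_def)
    also have "\<dots> = (\<integral>\<^sup>+y. ennreal (\<bar>H y \<bullet> w\<bar> * indicator (cball 0 1) w) \<partial>lborel)"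
      by (intro nn_integral_eq_integral[symmetric] integrable_mult_left int) auto
    finally show "ennreal (N w * indicator (cball 0 1) w) = (\<integral>\<^sup>+y. ennreal (\<bar>H y \<bullet> w\<bar> * indicator (cball 0 1) w) \<partial>lborel)" .
  qed
  also have "\<dots> = (\<integral>\<^sup>+y. (\<integral>\<^sup>+w. ennreal (\<bar>H y \<bullet> w\<bar> * indicator (cball 0 1) w) \<partial>lborel) \<partial>lborel)"
    by (rule lborel_pair.Fubini') measurable
  also have "\<dots> = (\<integral>\<^sup>+y. ennreal (norm (H y) * c) \<partial>lborel)"
    unfolding c_def n_def by (simp only: nn_integral_abs_inner_cball)
  also have "\<dots> = ennreal (h * c)"
    using c0 by (subst nn_integral_eq_integral) (auto simp: h_def inth)
  finally have A: "A = h * c"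
    using c0 h0 by (subst (asm) ennreal_inj) (auto simp: A_def N0)
  have hpos: "h > 0"
    using lip[of u 0] Nu u(1) by (simp add: Nzero)
  have Apos: "A > 0" using A c0 hpos by simp
  have "measure lborel K powr (1 / n) \<ge> unit_ball_vol n powr (1 / n) * (n * unit_ball_vol n / ((n + 1) * A))"
    using measure_norm_ball_ge[OF cont hom N0 Nzero _ A_def Apos] bK unfolding K n_def by (simp add: add.commute)
  also have "(n + 1) * A = 2 * unit_ball_vol (n - 1) * h"
    unfolding A c_def n_def by simp
  finally show "measure lborel K powr (1 / n) * (2 * unit_ball_vol (n - 1) * (\<integral>y. norm (H y) \<partial>lborel))
      \<ge> unit_ball_vol n powr (1 / n) * (n * unit_ball_vol n)"
    using hpos unfolding h_def[symmetric] n_def by (simp add: pos_divide_le_eq mult.assoc)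
qed

section \<open>Smooth test functions\<close>

text \<open>The functions \<open>exp (-1/t) / t\<^sup>m\<close>, extended by 0, span a space closed under differentiation; this makes the
smoothness of \<open>exp (-1/t)\<close> at 0 a matter of first derivatives only.\<close>

definition flat_exp :: "nat \<Rightarrow> real \<Rightarrow> real" where
  "flat_exp m t = (if t > 0 then exp (- 1 / t) / t ^ m else 0)"

lemma flat_exp_tendsto_0: "(flat_exp m \<longlongrightarrow> 0) (at 0)"
proof -
  have "((\<lambda>x::real. x ^ m / exp x) \<longlongrightarrow> 0) at_top"
    by (rule tendsto_power_div_exp_0)
  then have "((\<lambda>t::real. inverse t ^ m / exp (inverse t)) \<longlongrightarrow> 0) (at_right 0)"
    by (rule filterlim_compose) (rule filterlim_inverse_at_top_right)
  moreover have "eventually (\<lambda>t. inverse t ^ m / exp (inverse t) = flat_exp m t) (at_right (0::real))"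
    unfolding flat_exp_def eventually_at_filter
    by (auto simp: exp_minus field_simps)
  ultimately have "(flat_exp m \<longlongrightarrow> 0) (at_right 0)"
    by (rule Lim_transform_eventually)
  moreover have "(flat_exp m \<longlongrightarrow> 0) (at_left 0)"
    by (rule tendsto_eventually) (auto simp: flat_exp_def eventually_at_filter)
  ultimately show ?thesis
    by (simp add: filterlim_split_at)
qed

lemma flat_exp_deriv:
  "(flat_exp m has_real_derivative flat_exp (m + 2) t - m * flat_exp (m + 1) t) (at t)"
proof -
  consider "t > 0" | "t < 0" | "t = 0" by linarith
  then show ?thesis
  proof cases
    case 1
    have "((\<lambda>t. exp (- 1 / t) * inverse (t ^ m)) has_real_derivative flat_exp (m + 2) t - m * flat_exp (m + 1) t) (at t)"
      using 1
      by (cases m) (auto intro!: derivative_eq_intros simp: flat_exp_def divide_simps power2_eq_square, simp add: algebra_simps power_eq_if)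
    then show ?thesis
      by (rule has_field_derivative_transform_within[where d = t])
        (use 1 in \<open>auto simp: flat_exp_def dist_real_def divide_inverse\<close>)
  next
    case 2
    have "((\<lambda>t. 0) has_real_derivative flat_exp (m + 2) t - m * flat_exp (m + 1) t) (at t)"
      using 2 by (auto simp: flat_exp_def)
    then show ?thesis
      by (rule has_field_derivative_transform_within[where d = "-t"])
        (use 2 in \<open>auto simp: flat_exp_def dist_real_def\<close>)
  next
    case 3
    have "eventually (\<lambda>h. flat_exp (Suc m) h = (flat_exp m (0 + h) - flat_exp m 0) / h) (at 0)"
      by (auto simp: flat_exp_def eventually_at_filter)
    with flat_exp_tendsto_0[of "Suc m"] have "((\<lambda>h. (flat_exp m (0 + h) - flat_exp m 0) / h) \<longlongrightarrow> 0) (at 0)"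
      by (rule Lim_transform_eventually)
    then show ?thesis using 3 by (simp add: DERIV_def flat_exp_def)
  qed
qed

text \<open>A family that contains the polynomials and a bump function and is visibly closed under partial derivatives.
Such closure is all that infinite differentiability requires.\<close>

inductive_set smooth_funs :: "('a::euclidean_space \<Rightarrow> real) set" where
  const: "(\<lambda>_. c) \<in> smooth_funs"
| inner: "(\<lambda>x. x \<bullet> b) \<in> smooth_funs"
| add: "p \<in> smooth_funs \<Longrightarrow> q \<in> smooth_funs \<Longrightarrow> (\<lambda>x. p x + q x) \<in> smooth_funs"
| mult: "p \<in> smooth_funs \<Longrightarrow> q \<in> smooth_funs \<Longrightarrow> (\<lambda>x. p x * q x) \<in> smooth_funs"
| flat: "p \<in> smooth_funs \<Longrightarrow> (\<lambda>x. flat_exp m (p x)) \<in> smooth_funs"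

lemma smooth_funs_derivative:
  "p \<in> smooth_funs \<Longrightarrow> \<exists>D. (\<forall>x. (p has_derivative D x) (at x)) \<and> (\<forall>h. (\<lambda>x. D x h) \<in> smooth_funs)"
proof (induction rule: smooth_funs.induct)
  case (const c)
  show ?case by (rule exI[of _ "\<lambda>x h. 0"]) (auto intro: smooth_funs.const)
next
  case (inner b)
  show ?case by (rule exI[of _ "\<lambda>x h. h \<bullet> b"])
    (auto intro: smooth_funs.const intro!: derivative_eq_intros)
next
  case (add p q)
  then obtain D E where "\<forall>x. (p has_derivative D x) (at x)" "\<forall>h. (\<lambda>x. D x h) \<in> smooth_funs"
    "\<forall>x. (q has_derivative E x) (at x)" "\<forall>h. (\<lambda>x. E x h) \<in> smooth_funs" by blast
  then show ?case
    by (intro exI[of _ "\<lambda>x h. D x h + E x h"]) (auto intro: smooth_funs.add has_derivative_add)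
next
  case (mult p q)
  then obtain D E where "\<forall>x. (p has_derivative D x) (at x)" "\<forall>h. (\<lambda>x. D x h) \<in> smooth_funs"
    "\<forall>x. (q has_derivative E x) (at x)" "\<forall>h. (\<lambda>x. E x h) \<in> smooth_funs" by blast
  then show ?case using mult.hyps
    by (intro exI[of _ "\<lambda>x h. p x * E x h + D x h * q x"])
      (auto intro!: smooth_funs.add smooth_funs.mult has_derivative_mult)
next
  case (flat p m)
  then obtain D where D: "\<forall>x. (p has_derivative D x) (at x)" "\<forall>h. (\<lambda>x. D x h) \<in> smooth_funs"
    by blast
  have 1: "((\<lambda>x. flat_exp m (p x)) has_derivative
      (\<lambda>h. (flat_exp (m + 2) (p x) + (- real m) * flat_exp (m + 1) (p x)) * D x h)) (at x)" for x
    using has_derivative_compose[OF D(1)[rule_format, of x]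
      flat_exp_deriv[unfolded has_field_derivative_def, of m "p x"]]
    by (simp add: algebra_simps)
  have 2: "(\<lambda>x. (flat_exp (m + 2) (p x) + (- real m) * flat_exp (m + 1) (p x)) * D x h) \<in> smooth_funs" for h
    by (intro smooth_funs.mult smooth_funs.add smooth_funs.flat smooth_funs.const flat.hyps D(2)[rule_format])
  show ?case using 1 2
    by (intro exI[of _ "\<lambda>x h. (flat_exp (m + 2) (p x) + (- real m) * flat_exp (m + 1) (p x)) * D x h"]) auto
qed

lemma smooth_funs_has_derivative:
  assumes "p \<in> smooth_funs"
  shows "(p has_derivative frechet_derivative p (at x)) (at x)"
  using smooth_funs_derivative[OF assms] by (metis frechet_derivative_at)

lemma smooth_funs_partial:
  assumes "p \<in> smooth_funs"
  shows "(\<lambda>x. frechet_derivative p (at x) h) \<in> smooth_funs"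
proof -
  obtain D where D: "\<forall>x. (p has_derivative D x) (at x)" "\<forall>h. (\<lambda>x. D x h) \<in> smooth_funs"
    using smooth_funs_derivative[OF assms] by blast
  then have "frechet_derivative p (at x) = D x" for x
    by (metis frechet_derivative_at)
  with D show ?thesis by simp
qed

lemma smooth_funs_differentiable: "p \<in> smooth_funs \<Longrightarrow> p differentiable_on UNIV"
  unfolding differentiable_on_def differentiable_def
  by (auto dest: smooth_funs_has_derivative)

lemma smooth_funs_continuous: "p \<in> smooth_funs \<Longrightarrow> continuous_on S p"
  by (rule continuous_on_subset[OF differentiable_imp_continuous_on[OF smooth_funs_differentiable]]) auto

text \<open>Closure under partial derivatives lets the order drop by one at every step of the induction.\<close>

lemma smooth_funs_Ck: "p \<in> smooth_funs \<Longrightarrow> Ck k p"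
  by (induction k arbitrary: p)
    (simp_all add: smooth_funs_continuous smooth_funs_differentiable smooth_funs_partial)

lemma smooth_funs_sum:
  "finite I \<Longrightarrow> (\<And>i. i \<in> I \<Longrightarrow> p i \<in> smooth_funs) \<Longrightarrow> (\<lambda>x. \<Sum>i\<in>I. p i x) \<in> smooth_funs"
  by (induction rule: finite_induct) (auto intro: smooth_funs.const smooth_funs.add)

lemma linear_in_smooth_funs:
  fixes p :: "'a::euclidean_space \<Rightarrow> real"
  assumes "linear p"
  shows "p \<in> smooth_funs"
proof -
  have "p x = (\<Sum>b\<in>Basis. (x \<bullet> b) * p b)" for x
  proof -
    have "p x = p (\<Sum>b\<in>Basis. (x \<bullet> b) *\<^sub>R b)" by (simp add: euclidean_representation)
    also have "\<dots> = (\<Sum>b\<in>Basis. (x \<bullet> b) * p b)" using assms by (simp add: linear_sum linear_cmul)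
    finally show ?thesis .
  qed
  then have p: "p = (\<lambda>x. \<Sum>b\<in>Basis. (x \<bullet> b) * p b)" by (rule ext)
  show ?thesis
    by (subst p) (intro smooth_funs_sum smooth_funs.mult smooth_funs.inner smooth_funs.const, auto)
qed

lemma real_polynomial_function_in_smooth_funs:
  "real_polynomial_function p \<Longrightarrow> p \<in> smooth_funs"
  by (induction rule: real_polynomial_function.induct)
    (auto intro: smooth_funs.const smooth_funs.add smooth_funs.mult linear_in_smooth_funs
      bounded_linear.linear)

text \<open>The factor \<open>exp 1\<close> normalizes the value at the origin to 1, so that \<open>bump R\<close> increases to 1 as \<open>R\<close> grows.\<close>

definition bump :: "real \<Rightarrow> 'a::euclidean_space \<Rightarrow> real" where
  "bump R x = exp 1 * flat_exp 0 (1 - (x \<bullet> x) / R\<^sup>2)"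

lemma inner_self_in_smooth_funs: "(\<lambda>x::'a::euclidean_space. x \<bullet> x) \<in> smooth_funs"
proof -
  have "(\<lambda>x::'a. \<Sum>b\<in>Basis. (x \<bullet> b) * (x \<bullet> b)) \<in> smooth_funs"
    by (intro smooth_funs_sum smooth_funs.mult smooth_funs.inner) auto
  then show ?thesis by (subst euclidean_inner)
qed

lemma bump_in_smooth_funs: "bump R \<in> smooth_funs"
proof -
  have "(\<lambda>x::'a. exp 1 * flat_exp 0 (1 + (- 1 / R\<^sup>2) * (x \<bullet> x))) \<in> smooth_funs"
    by (intro smooth_funs.mult smooth_funs.flat smooth_funs.add smooth_funs.const inner_self_in_smooth_funs)
  then show ?thesis by (simp add: bump_def[abs_def])
qed

lemma bump_nonneg: "bump R x \<ge> 0"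
  by (simp add: bump_def flat_exp_def)

lemma bump_le_1: "bump R x \<le> 1"
proof (cases "1 - (x \<bullet> x) / R\<^sup>2 > 0")
  case True
  let ?t = "1 - (x \<bullet> x) / R\<^sup>2"
  have "?t \<le> 1" by simp
  then have "- 1 / ?t \<le> - 1" using True by (simp add: field_simps)
  then have "exp (- 1 / ?t) \<le> exp (- 1)" by (simp only: exp_le_cancel_iff)
  then have "exp 1 * exp (- 1 / ?t) \<le> exp 1 * exp (- 1)" by (intro mult_left_mono) auto
  then show ?thesis using True by (simp add: bump_def flat_exp_def flip: exp_add)
qed (simp add: bump_def flat_exp_def)

lemma bump_pos: "R > 0 \<Longrightarrow> norm x < R \<Longrightarrow> bump R x > 0"
  by (simp add: bump_def flat_exp_def power_strict_mono flip: power2_norm_eq_inner)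

lemma bump_zero: "R > 0 \<Longrightarrow> norm x \<ge> R \<Longrightarrow> bump R x = 0"
  by (simp add: bump_def flat_exp_def power_mono not_less flip: power2_norm_eq_inner)

lemma test_fun_smooth:
  assumes "p \<in> smooth_funs" "\<And>x. norm x \<ge> R \<Longrightarrow> p x = 0"
  shows "test_fun p"
proof -
  have "{x. p x \<noteq> 0} \<subseteq> cball 0 R" using assms(2) by (force simp: not_le)
  then have "bounded {x. p x \<noteq> 0}" using bounded_cball bounded_subset by blast
  then show ?thesis unfolding test_fun_def compact_closure using smooth_funs_Ck[OF assms(1)] by blast
qed

lemma bump_derivative:
  assumes "R > 0"
  shows "frechet_derivative (bump R) (at x) h = - (2 * exp 1 / R\<^sup>2) * flat_exp 2 (1 - (x \<bullet> x) / R\<^sup>2) * (x \<bullet> h)"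
proof -
  have "((\<lambda>x. 1 - (x \<bullet> x) / R\<^sup>2) has_derivative (\<lambda>h. - (2 * (x \<bullet> h)) / R\<^sup>2)) (at x)"
    using assms
    by (auto intro!: derivative_eq_intros simp: inner_commute fun_eq_iff power2_eq_square power4_eq_xxxx)
  from has_derivative_compose[OF this flat_exp_deriv[unfolded has_field_derivative_def, of 0]]
  have "((\<lambda>x. flat_exp 0 (1 - (x \<bullet> x) / R\<^sup>2)) has_derivative 
      (\<lambda>h. flat_exp 2 (1 - (x \<bullet> x) / R\<^sup>2) * (- (2 * (x \<bullet> h)) / R\<^sup>2))) (at x)" by (simp add: numeral_2_eq_2)
  from has_derivative_mult_right[OF this, of "exp 1"]
  have "(bump R has_derivative (\<lambda>h. - (2 * exp 1 / R\<^sup>2) * flat_exp 2 (1 - (x \<bullet> x) / R\<^sup>2) * (x \<bullet> h))) (at x)"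
    unfolding bump_def[abs_def] by (rule has_derivative_eq_rhs) (auto simp: field_simps)
  then show ?thesis by (metis frechet_derivative_at)
qed

lemma flat_exp_bounded: "\<exists>C. \<forall>t\<le>1. \<bar>flat_exp m t\<bar> \<le> C"
proof -
  have "continuous_on {0..1} (flat_exp m)"
    using flat_exp_deriv[of m] by (intro continuous_at_imp_continuous_on) (auto intro: DERIV_isCont)
  then have "bounded (flat_exp m ` {0..1})"
    by (intro compact_imp_bounded compact_continuous_image) auto
  then obtain C where C: "\<forall>t\<in>{0..1}. \<bar>flat_exp m t\<bar> \<le> C"
    unfolding bounded_iff by auto
  have "\<bar>flat_exp m t\<bar> \<le> C" if "t \<le> 1" for t
  proof (cases "t \<ge> 0")
    case False
    then have "flat_exp m t = flat_exp m 0" by (simp add: flat_exp_def)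
    then show ?thesis using C[rule_format, of 0] by simp
  qed (use C that in auto)
  then show ?thesis by blast
qed

text \<open>The bound decays like \<open>1 / R\<close>, as for any family of dilates of one test function. On the support of
\<open>bump R\<close> it therefore controls derivatives in directions of size \<open>R\<close> uniformly in \<open>R\<close>.\<close>

lemma bump_derivative_bound:
  "\<exists>C. \<forall>R>0. \<forall>x h. \<bar>frechet_derivative (bump R) (at (x::'a::euclidean_space)) h\<bar> \<le> C * norm h / R"
proof -
  obtain C where C: "\<And>t. t \<le> 1 \<Longrightarrow> \<bar>flat_exp 2 t\<bar> \<le> C" using flat_exp_bounded[of 2] by blast
  have "\<bar>frechet_derivative (bump R) (at (x::'a)) h\<bar> \<le> 2 * exp 1 * C * norm h / R" if R: "R > 0" for R x h
  proof (cases "norm x < R")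
    case True
    have "\<bar>frechet_derivative (bump R) (at x) h\<bar> = 2 * exp 1 / R\<^sup>2 * \<bar>flat_exp 2 (1 - (x \<bullet> x) / R\<^sup>2)\<bar> * \<bar>x \<bullet> h\<bar>"
      unfolding bump_derivative[OF R] by (simp add: abs_mult)
    also have "\<dots> \<le> 2 * exp 1 / R\<^sup>2 * C * (R * norm h)"
    proof (intro mult_mono)
      have "\<bar>x \<bullet> h\<bar> \<le> norm x * norm h" by (rule Cauchy_Schwarz_ineq2)
      also have "\<dots> \<le> R * norm h" using True by (intro mult_right_mono) auto
      finally show "\<bar>x \<bullet> h\<bar> \<le> R * norm h" .
      show "0 \<le> 2 * exp 1 / R\<^sup>2 * C" using C[of 0] by (auto simp: flat_exp_def)
    qed (use C in auto)
    also have "\<dots> = 2 * exp 1 * C * norm h / R" using R by (simp add: power2_eq_square)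
    finally show ?thesis .
  next
    case False
    then have "R\<^sup>2 \<le> x \<bullet> x" using R by (simp add: power_mono flip: power2_norm_eq_inner)
    then have "flat_exp 2 (1 - (x \<bullet> x) / R\<^sup>2) = 0" using R by (simp add: flat_exp_def)
    then show ?thesis unfolding bump_derivative[OF R] using R C[of 0] by (simp add: flat_exp_def)
  qed
  then show ?thesis by blast
qed

lemma bump_tendsto_1: "((\<lambda>R. bump R x) \<longlongrightarrow> 1) at_top"
proof -
  have "((\<lambda>R. 1 - (x \<bullet> x) / R\<^sup>2) \<longlongrightarrow> 1 - 0) at_top"
    by (intro tendsto_intros tendsto_divide_0[OF tendsto_const] filterlim_at_top_imp_at_infinity 
       filterlim_pow_at_top filterlim_ident) auto
  moreover have "isCont (flat_exp 0) (1 - 0)" by (rule DERIV_isCont[OF flat_exp_deriv])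
  ultimately have "((\<lambda>R. flat_exp 0 (1 - (x \<bullet> x) / R\<^sup>2)) \<longlongrightarrow> flat_exp 0 (1 - 0)) at_top"
    by (metis isCont_tendsto_compose)
  from tendsto_mult[OF tendsto_const[of "exp 1"] this]
  show ?thesis unfolding bump_def by (simp add: flat_exp_def flip: exp_add)
qed

section \<open>Integrable log-concave functions\<close>

lemma exp_neg_nonneg: "exp_neg u \<ge> 0"
  by (simp add: exp_neg_def)

lemma log_concave_nonneg: "log_concave f \<Longrightarrow> f x \<ge> 0"
  unfolding log_concave_def using exp_neg_nonneg by metis

text \<open>This multiplicative form is the only way in which the convex exponent is used later. Where one of the
values of \<open>f\<close> is 0 the left-hand side vanishes.\<close>

lemma log_concave_ineq:
  assumes "log_concave f" "0 < t" "t < 1"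
  shows "f x powr (1 - t) * f y powr t \<le> f ((1 - t) *\<^sub>R x + t *\<^sub>R y)"
proof -
  obtain v where v: "\<And>x. v x \<noteq> -\<infinity>"
    "\<And>x y t. t\<in>{0..1} \<Longrightarrow> v ((1 - t) *\<^sub>R x + t *\<^sub>R y) \<le> ereal (1 - t) * v x + ereal t * v y"
    "\<And>x. f x = exp_neg (v x)"
    using assms(1) unfolding log_concave_def by blast
  let ?z = "(1 - t) *\<^sub>R x + t *\<^sub>R y"
  show ?thesis
  proof (cases "v x = \<infinity> \<or> v y = \<infinity>")
    case True
    then show ?thesis using assms by (auto simp: v(3) exp_neg_def)
  next
    case False
    then obtain a b where ab: "v x = ereal a" "v y = ereal b"
      using v(1) by (metis ereal_cases)
    have le: "v ?z \<le> ereal ((1 - t) * a + t * b)"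
      using v(2)[of t x y] assms ab by simp
    then obtain c where c: "v ?z = ereal c"
      using v(1)[of ?z] by (cases "v ?z") auto
    have "exp (- a) powr (1 - t) * exp (- b) powr t = exp (- ((1 - t) * a + t * b))"
      by (simp add: powr_def algebra_simps flip: exp_add)
    also have "\<dots> \<le> exp (- c)" using le c by simp
    finally show ?thesis using ab c by (simp add: v(3) exp_neg_def)
  qed
qed

lemma log_concave_superlevel_convex:
  assumes "log_concave f" "t > 0"
  shows "convex {x. f x \<ge> t}"
proof (rule convexI)
  fix x y and u w :: real assume *: "x \<in> {x. f x \<ge> t}" "y \<in> {x. f x \<ge> t}" "0 \<le> u" "0 \<le> w" "u + w = 1"
  show "u *\<^sub>R x + w *\<^sub>R y \<in> {x. f x \<ge> t}"
  proof (cases "w = 0 \<or> w = 1")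
    case True
    then show ?thesis using * by auto
  next
    case False
    then have w: "0 < w" "w < 1" "u = 1 - w" using * by auto
    have "t = t powr (1 - w) * t powr w" using assms(2) by (simp flip: powr_add)
    also have "\<dots> \<le> f x powr (1 - w) * f y powr w"
      using * assms w by (intro mult_mono powr_mono2) auto
    also have "\<dots> \<le> f (u *\<^sub>R x + w *\<^sub>R y)" using log_concave_ineq[OF assms(1) w(1,2)] w(3) by simp
    finally show ?thesis by simp
  qed
qed

locale integrable_log_concave =
  fixes f :: "'a::euclidean_space \<Rightarrow> real"
  assumes log_concave: "log_concave f"
    and usc: "upper_semicontinuous f"
    and integrable: "integrable lborel f"
    and integral_pos: "(\<integral>x. f x \<partial>lborel) > 0"
begin

lemma nonneg [simp]: "f x \<ge> 0"
  by (rule log_concave_nonneg[OF log_concave])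

lemma measurable_f [measurable]: "f \<in> borel_measurable borel"
  using borel_measurable_integrable[OF integrable] by simp

text \<open>Otherwise all superlevel sets are convex without interior, hence null sets, and \<open>f\<close> vanishes almost
everywhere.\<close>

lemma superlevel_contains_ball:
  "\<exists>t>0. \<exists>z. \<exists>r>0. \<forall>x\<in>cball z r. f x \<ge> t"
proof -
  have "\<exists>n::nat. interior {x. f x \<ge> 1 / Suc n} \<noteq> {}"
  proof (rule ccontr)
    assume "\<not> ?thesis"
    then have "negligible {x. f x \<ge> 1 / Suc n}" for n
      by (subst negligible_convex_interior) (auto intro: log_concave_superlevel_convex[OF log_concave])
    then have "AE x in lborel. \<not> f x \<ge> 1 / Suc n" for n
      by (intro AE_I'[of "{x. f x \<ge> 1 / Suc n}"])
        (auto simp: negligible_iff_null_sets null_sets_completion_iff)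
    then have "AE x in lborel. \<forall>n. \<not> f x \<ge> 1 / Suc n"
      by (simp add: AE_all_countable)
    moreover have "f x = 0" if "\<forall>n. \<not> f x \<ge> 1 / Suc n" for x
    proof (rule ccontr)
      assume "f x \<noteq> 0"
      then have "f x > 0" using nonneg[of x] by linarith
      then obtain n where "1 / Suc n < f x" using nat_approx_posE by blast
      then show False using that by (meson less_imp_le)
    qed
    ultimately have "AE x in lborel. f x = 0" by (auto elim: eventually_mono)
    then have "(\<integral>x. f x \<partial>lborel) = 0" by (rule integral_eq_zero_AE)
    with integral_pos show False by simp
  qed
  then obtain n z where "z \<in> interior {x. f x \<ge> 1 / Suc (n::nat)}" by blast
  then obtain r where "r > 0" "cball z r \<subseteq> {x. f x \<ge> 1 / Suc n}"
    unfolding mem_interior_cball by blast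
  then show ?thesis by (intro exI[of _ "1 / Suc n"] conjI exI[of _ z] exI[of _ r]) auto
qed

lemma const_times_measure_le_integral:
  assumes "\<And>x. x \<in> S \<Longrightarrow> f x \<ge> s" "S \<in> fmeasurable lborel"
  shows "s * measure lborel S \<le> (\<integral>x. f x \<partial>lborel)"
proof -
  have int: "integrable lborel (\<lambda>x. s * indicator S x :: real)"
    using assms(2) by (intro integrable_mult_right integrable_real_indicator) (auto simp: fmeasurable_def)
  have "s * measure lborel S = (\<integral>x. s * indicator S x \<partial>lborel)"
    using assms(2) by (subst integral_mult_right_zero) (auto simp: fmeasurable_def)
  also have "\<dots> \<le> (\<integral>x. f x \<partial>lborel)"
    by (intro integral_mono int integrable) (auto simp: indicator_def assms(1))
  finally show ?thesis .
qed

text \<open>A large value at \<open>p\<close> forces values at least \<open>sqrt (t f(p))\<close> on the ball halfway between \<open>p\<close> and a ball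
on which \<open>f \<ge> t\<close>. The volume of that ball does not depend on \<open>p\<close>.\<close>

lemma bounded_above: "bdd_above (range f)"
proof -
  obtain t z r where t: "t > 0" "r > 0" "\<And>x. x \<in> cball z r \<Longrightarrow> f x \<ge> t"
    using superlevel_contains_ball by blast
  define I where "I = (\<integral>x. f x \<partial>lborel)"
  define c where "c = measure lborel (cball z (r / 2))"
  have c: "c > 0" using t(2) unfolding c_def by (subst content_cball) auto
  have "f p \<le> (I / c)\<^sup>2 / t" for p
  proof -
    let ?q = "(1/2) *\<^sub>R (z + p)"
    have "sqrt (t * f p) * measure lborel (cball ?q (r / 2)) \<le> I"
      unfolding I_def
    proof (rule const_times_measure_le_integral)
      fix x assume x: "x \<in> cball ?q (r / 2)"
      define y where "y = 2 *\<^sub>R x - p"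
      have xe: "x = (1 - 1/2) *\<^sub>R y + (1/2) *\<^sub>R p" by (simp add: y_def scaleR_diff_right)
      have "z - y = 2 *\<^sub>R (?q - x)" by (simp add: y_def algebra_simps)
      then have "dist z y = 2 * dist ?q x" unfolding dist_norm by (simp only: norm_scaleR)
      then have "f y \<ge> t" using x t(3) by simp
      then have "sqrt (t * f p) \<le> sqrt (f y * f p)" by (simp add: mult_right_mono)
      also have "\<dots> = f y powr (1 - 1/2) * f p powr (1/2)" by (simp add: powr_half_sqrt real_sqrt_mult)
      also have "\<dots> \<le> f x" unfolding xe by (rule log_concave_ineq[OF log_concave]) auto
      finally show "sqrt (t * f p) \<le> f x" .
    qed (use emeasure_bounded_finite[OF bounded_cball] in \<open>simp add: fmeasurable_def\<close>)
    moreover have "measure lborel (cball ?q (r / 2)) = c" unfolding c_def using t(2) by (simp add: content_cball)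
    ultimately have "sqrt (t * f p) \<le> I / c" using c by (simp add: field_simps)
    then have "t * f p \<le> (I / c)\<^sup>2" using t(1) nonneg[of p]
      by (metis real_sqrt_le_iff' sqrt_le_D)
    then show ?thesis using t(1) by (simp add: pos_le_divide_eq mult.commute)
  qed
  then show ?thesis by (intro bdd_aboveI[of _ "(I / c)\<^sup>2 / t"]) auto
qed

lemma le_sup_norm: "f x \<le> sup_norm f"
  unfolding sup_norm_def by (rule cSUP_upper[OF _ bounded_above]) auto

lemma sup_norm_pos: "sup_norm f > 0"
proof -
  obtain t z r where t: "t > 0" "r > 0" "\<And>x. x \<in> cball z r \<Longrightarrow> f x \<ge> t"
    using superlevel_contains_ball by blast
  then have "t \<le> f z" by simp
  then show ?thesis using t(1) le_sup_norm[of z] by linarith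
qed

text \<open>A superlevel set that contains a ball and a point far from it contains, by convexity, a long row of
disjoint balls of half the radius along the connecting segment, and the integral of \<open>f\<close> bounds their
number.\<close>

lemma superlevel_bounded:
  assumes "s > 0"
  shows "bounded {x. f x \<ge> s}"
proof -
  obtain t z r where t: "t > 0" "r > 0" "\<And>x. x \<in> cball z r \<Longrightarrow> f x \<ge> t"
    using superlevel_contains_ball by blast
  \<comment> \<open>Lowering the level only enlarges the set and makes it contain the given ball.\<close>
  define m where "m = min s t"
  have m: "m > 0" "m \<le> s" "m \<le> t" using assms t by (auto simp: m_def)
  define I where "I = (\<integral>x. f x \<partial>lborel)"
  define c where "c = measure lborel (ball z (r / 2))"
  have c: "c > 0" using t(2) unfolding c_def by (subst content_ball) auto
  obtain N :: nat where N: "N > I / (m * c)" using reals_Archimedean2 by blast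
  have "norm (p - z) \<le> 2 * r * N" if p: "f p \<ge> s" for p
  proof (rule ccontr)
    assume far: "\<not> ?thesis"
    define L where "L = norm (p - z)"
    define q where "q k = z + (real k * r / L) *\<^sub>R (p - z)" for k :: nat
    have L: "L > 2 * r * N" "L > 0" using far t(2) unfolding L_def
      by (auto intro: less_le_trans[of 0 "2 * r * N"] simp: not_le) (smt (verit) mult_nonneg_nonneg of_nat_0_le_iff)
    have sub: "ball (q k) (r / 2) \<subseteq> {x. f x \<ge> m}" if k: "k < N" for k
    proof
      fix x assume x: "x \<in> ball (q k) (r / 2)"
      define u where "u = real k * r / L"
      have u: "0 \<le> u" "u < 1 / 2"
      proof -
        have "2 * r * real k \<le> 2 * r * N" using k t(2) by simp
        then have "2 * r * real k < L" using L by linarith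
        then show "0 \<le> u" "u < 1 / 2" using L t(2) by (auto simp: u_def field_simps)
      qed
      \<comment> \<open>The point of the ball around \<open>z\<close> that the contraction towards \<open>p\<close> with ratio \<open>1 - u\<close> sends to \<open>x\<close>.\<close>
      define y where "y = z + (1 / (1 - u)) *\<^sub>R (x - q k)"
      have "norm ((1 / (1 - u)) *\<^sub>R (x - q k)) = norm (x - q k) / (1 - u)" using u by simp
      also have "\<dots> \<le> (r / 2) / (1 - u)" using x u by (intro divide_right_mono) (auto simp: dist_norm norm_minus_commute)
      also have "\<dots> \<le> r" using u t(2) by (simp add: field_simps)
      finally have "y \<in> cball z r" by (simp add: y_def dist_norm)
      then have "t \<le> f y" by (rule t(3))
      then have ym: "y \<in> {x. f x \<ge> m}" using m by simp
      have pm: "p \<in> {x. f x \<ge> m}" using p m by auto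
      have "(1 - u) *\<^sub>R y = (1 - u) *\<^sub>R z + (x - q k)"
        using u by (simp add: y_def scaleR_add_right)
      moreover have qk: "q k = z + u *\<^sub>R (p - z)" by (simp add: q_def u_def)
      ultimately have "x = (1 - u) *\<^sub>R y + u *\<^sub>R p"
        unfolding qk by (simp add: algebra_simps)
      then show "x \<in> {x. f x \<ge> m}"
        using convexD_alt[OF log_concave_superlevel_convex[OF log_concave m(1)] ym pm, of u] u by simp
    qed
    have disj: "disjoint_family_on (\<lambda>k. ball (q k) (r / 2)) {..<N}"
      unfolding disjoint_family_on_def
    proof (intro ballI impI)
      fix j k :: nat assume jk: "j \<noteq> k"
      have "r * 1 \<le> r * \<bar>real j - real k\<bar>" using jk t(2) by (intro mult_left_mono) auto
      moreover have "q j - q k = ((real j - real k) * r / L) *\<^sub>R (p - z)"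
        by (simp add: q_def algebra_simps diff_divide_distrib)
      then have "r * \<bar>real j - real k\<bar> = dist (q j) (q k)"
        using L t(2) by (simp add: dist_norm L_def[symmetric] abs_mult)
      ultimately have "r \<le> dist (q j) (q k)" by simp
      then show "ball (q j) (r / 2) \<inter> ball (q k) (r / 2) = {}"
        by (intro disjoint_ballI) simp
    qed
    have bc: "measure lborel (ball (q k) (r / 2)) = c" for k unfolding c_def using t(2) by (simp add: content_ball)
    have fin: "ball (q k) (r / 2) \<in> fmeasurable lborel" for k
      using emeasure_bounded_finite[OF bounded_ball] by (simp add: fmeasurable_def)
    have "measure lborel (\<Union>k<N. ball (q k) (r / 2)) = (\<Sum>k<N. measure lborel (ball (q k) (r / 2)))"
      using fin disj by (intro measure_finite_Union) (auto simp: fmeasurable_def less_top)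
    then have "m * (N * c) = m * measure lborel (\<Union>k<N. ball (q k) (r / 2))" by (simp add: bc)
    also have "\<dots> \<le> I" unfolding I_def
      using sub fin by (intro const_times_measure_le_integral fmeasurable.finite_UN) blast+
    finally have "m * (N * c) \<le> I" .
    moreover have "I < N * (m * c)" using N m c by (simp add: pos_divide_less_eq)
    ultimately show False by (simp add: mult_ac)
  qed
  then have "{x. f x \<ge> s} \<subseteq> cball z (2 * r * N)" by (auto simp: dist_norm norm_minus_commute)
  then show ?thesis using bounded_cball bounded_subset by blast
qed

text \<open>Log-concavity at the midpoint gives \<open>sqrt (f z) sqrt (f x) \<le> f ((z + x) / 2)\<close>, and the right-hand side is
integrable in \<open>x\<close>. This replaces the exponential decay of log-concave functions.\<close>

lemma sqrt_integrable: "integrable lborel (\<lambda>x. sqrt (f x))"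
proof -
  obtain t z r where t: "t > 0" "r > 0" "\<And>x. x \<in> cball z r \<Longrightarrow> f x \<ge> t"
    using superlevel_contains_ball by blast
  have fz: "f z > 0" using t(1) t(2) t(3)[of z] by (metis centre_in_cball less_eq_real_def less_le_trans)
  have 1: "integrable lborel (\<lambda>x. f ((1/2) *\<^sub>R z + (1/2) *\<^sub>R x))"
    using lborel_integrable_affine[OF integrable, of "1/2" "(1/2) *\<^sub>R z"] by simp
  show ?thesis
  proof (rule Bochner_Integration.integrable_bound)
    show "integrable lborel (\<lambda>x. (1 / sqrt (f z)) * f ((1/2) *\<^sub>R z + (1/2) *\<^sub>R x))"
      using 1 by simp
    have "sqrt (f x) \<le> (1 / sqrt (f z)) * f ((1/2) *\<^sub>R z + (1/2) *\<^sub>R x)" for x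
    proof -
      have "sqrt (f z) * sqrt (f x) \<le> f ((1/2) *\<^sub>R z + (1/2) *\<^sub>R x)"
        using log_concave_ineq[OF log_concave, of "1/2" z x] by (simp add: powr_half_sqrt)
      then show ?thesis using fz by (simp add: field_simps)
    qed
    then show "AE x in lborel. norm (sqrt (f x)) \<le> norm ((1 / sqrt (f z)) * f ((1/2) *\<^sub>R z + (1/2) *\<^sub>R x))"
      using fz by (intro AE_I2) (simp add: order_trans[OF _ abs_ge_self])
  qed simp
qed

text \<open>Since \<open>ln u \<le> u\<close> for \<open>u = sqrt (M / f)\<close>, the function is dominated by a multiple of \<open>sqrt f\<close>.\<close>

lemma f_ln_integrable:
  assumes "c > 0"
  shows "integrable lborel (\<lambda>x. f x * ln (f x / c))"
proof -
  define M where "M = sup_norm f"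
  have M: "M > 0" "\<And>x. f x \<le> M" using sup_norm_pos le_sup_norm by (auto simp: M_def)
  have bound: "\<bar>f x * ln (f x / M)\<bar> \<le> 2 * sqrt M * sqrt (f x)" for x
  proof (cases "f x = 0")
    case False
    then have f: "f x > 0" using nonneg[of x] by linarith
    have "ln (sqrt (M / f x)) \<le> sqrt (M / f x)" using f M by (intro less_imp_le[OF ln_less_self]) auto
    then have "ln (M / f x) \<le> 2 * sqrt (M / f x)" using f M by (simp add: ln_sqrt)
    moreover have "0 \<le> ln (M / f x)" using f M(2)[of x] by simp
    moreover have "ln (f x / M) = - ln (M / f x)" using f M by (simp add: ln_div)
    ultimately have "\<bar>f x * ln (f x / M)\<bar> \<le> f x * (2 * sqrt (M / f x))"
      using f by (simp add: abs_mult)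
    also have "\<dots> = 2 * sqrt M * (f x / sqrt (f x))" by (simp add: real_sqrt_divide)
    also have "f x / sqrt (f x) = sqrt (f x)" using f by (simp add: real_div_sqrt)
    finally show ?thesis .
  qed simp
  have 1: "integrable lborel (\<lambda>x. f x * ln (f x / M))"
  proof (rule Bochner_Integration.integrable_bound)
    show "integrable lborel (\<lambda>x. 2 * sqrt M * sqrt (f x))" using sqrt_integrable by simp
    show "AE x in lborel. norm (f x * ln (f x / M)) \<le> norm (2 * sqrt M * sqrt (f x))"
      using bound M(1) by (intro AE_I2) simp
  qed simp
  have "f x * ln (f x / c) = f x * ln (f x / M) + ln (M / c) * f x" for x
    using nonneg[of x] M(1) assms by (cases "f x = 0") (auto simp: ln_div algebra_simps)
  then show ?thesis using 1 integrable by simp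
qed

end

section \<open>Existence of the John ellipsoid\<close>

context integrable_log_concave
begin

text \<open>This is where upper semicontinuity enters; it closes the parameter set of the maximization problem.\<close>

lemma hypograph_closed: "closed {(a, x). a \<le> f x}"
  unfolding closed_sequential_limits
proof (intro allI impI, elim conjE)
  fix p l assume p: "\<forall>n. p n \<in> {(a, x). a \<le> f x}" and lim: "p \<longlonglongrightarrow> l"
  obtain a x where l: "l = (a, x)" by (cases l)
  have la: "(\<lambda>n. fst (p n)) \<longlonglongrightarrow> a" and lx: "(\<lambda>n. snd (p n)) \<longlonglongrightarrow> x"
    using tendsto_fst[OF lim] tendsto_snd[OF lim] by (simp_all add: l)
  have "a \<le> f x"
  proof (rule ccontr)
    assume "\<not> a \<le> f x"
    then obtain c where c: "f x < c" "c < a" using dense[of "f x" a] by auto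
    have "\<forall>\<^sub>F y in nhds x. f y < c" using usc c(1) unfolding upper_semicontinuous_def by blast
    then have "\<forall>\<^sub>F n in sequentially. f (snd (p n)) < c" using lx by (rule eventually_compose_filterlim)
    moreover have "\<forall>\<^sub>F n in sequentially. c < fst (p n)" using order_tendstoD(1)[OF la c(2)] .
    ultimately have "\<forall>\<^sub>F n in sequentially. False"
    proof eventually_elim
      case (elim n)
      then show ?case using p[rule_format, of n] by (auto simp: case_prod_beta)
    qed
    then show False by simp
  qed
  then show "l \<in> {(a, x). a \<le> f x}" by (simp add: l)
qed

text \<open>The functions \<open>min f (1/k)\<close> decrease to 0 and are dominated by \<open>f\<close>. In the maximization this keeps the
height of competing ellipsoid functions away from 0.\<close>

lemma small_level_mass:
  assumes "e > 0"
  obtains s where "s > 0" "\<And>a S. 0 \<le> a \<Longrightarrow> a < s \<Longrightarrow> compact S \<Longrightarrow> (\<And>x. x \<in> S \<Longrightarrow> a \<le> f x) \<Longrightarrow> a * measure lborel S < e"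
proof -
  have "(\<lambda>k. \<integral>x. min (f x) (1 / real (Suc k)) \<partial>lborel) \<longlonglongrightarrow> (\<integral>x. 0 \<partial>(lborel :: 'a measure))"
  proof (rule integral_dominated_convergence[where w = f])
    show "AE x in lborel. (\<lambda>k. min (f x) (1 / real (Suc k))) \<longlonglongrightarrow> 0"
    proof (rule AE_I2)
      fix x
      have "(\<lambda>k. min (f x) (1 / real (Suc k))) \<longlonglongrightarrow> min (f x) 0"
        by (intro tendsto_min tendsto_const LIMSEQ_Suc[OF lim_1_over_n])
      then show "(\<lambda>k. min (f x) (1 / real (Suc k))) \<longlonglongrightarrow> 0" by (simp add: min_absorb2)
    qed
  qed (use integrable in \<open>auto simp: min_def\<close>)
  then have "(\<lambda>k. \<integral>x. min (f x) (1 / real (Suc k)) \<partial>lborel) \<longlonglongrightarrow> 0" by simp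
  then have "\<forall>\<^sub>F k in sequentially. (\<integral>x. min (f x) (1 / real (Suc k)) \<partial>lborel) < e"
    using assms order_tendstoD(2) by blast
  then obtain k where k: "(\<integral>x. min (f x) (1 / real (Suc k)) \<partial>lborel) < e"
    using eventually_happens'[OF sequentially_bot] by blast
  show thesis
  proof (rule that[of "1 / real (Suc k)"])
    fix a S assume a: "0 \<le> a" "a < 1 / real (Suc k)" and S: "compact S" "\<And>x. x \<in> S \<Longrightarrow> a \<le> f x"
    have Sm: "S \<in> sets borel" "emeasure lborel S < \<infinity>"
      using S(1) emeasure_compact_finite by (auto simp: borel_compact)
    have int: "integrable lborel (\<lambda>x. a * indicator S x)"
      using Sm by (intro integrable_mult_right integrable_real_indicator) auto
    have int2: "integrable lborel (\<lambda>x. min (f x) (1 / real (Suc k)))"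
      by (rule Bochner_Integration.integrable_bound[OF integrable]) auto
    have "a * measure lborel S = (\<integral>x. a * indicator S x \<partial>lborel)"
      using Sm by (subst integral_mult_right_zero) auto
    also have "\<dots> \<le> (\<integral>x. min (f x) (1 / real (Suc k)) \<partial>lborel)"
      using a S by (intro integral_mono int int2) (auto simp: indicator_def)
    finally show "a * measure lborel S < e" using k by linarith
  qed simp
qed

end

definition ellipsoid_at :: "real^'n \<Rightarrow> real^'n^'n \<Rightarrow> (real^'n) set" where
  "ellipsoid_at c A = (\<lambda>w. c + A *v w) ` cball 0 1"

lemma compact_ellipsoid_at: "compact (ellipsoid_at c A)"
  unfolding ellipsoid_at_def
  by (intro compact_continuous_image compact_cball continuous_intros linear_continuous_on
      linear_conv_bounded_linear[THEN iffD1] matrix_vector_mul_linear)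

lemma ellipsoid_iff:
  fixes E :: "(real^'n) set"
  shows "ellipsoid E \<longleftrightarrow> (\<exists>c A. bij ((*v) A) \<and> E = ellipsoid_at c A)"
proof
  assume "ellipsoid E"
  then obtain c and T :: "real^'n \<Rightarrow> real^'n" where T: "linear T" "bij T" "E = (\<lambda>x. c + T x) ` cball 0 1"
    unfolding ellipsoid_def by blast
  have "(*v) (matrix T) = T" using T(1) by (auto simp: matrix_works)
  then show "\<exists>c A. bij ((*v) A) \<and> E = ellipsoid_at c A"
    using T by (intro exI[of _ c] exI[of _ "matrix T"]) (simp add: ellipsoid_at_def)
next
  assume "\<exists>c A. bij ((*v) A) \<and> E = ellipsoid_at c A"
  then show "ellipsoid E"
    unfolding ellipsoid_def ellipsoid_at_def using matrix_vector_mul_linear by blast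
qed

lemma measure_ellipsoid_at:
  "measure lborel (ellipsoid_at c (A :: real^'n^'n)) = vol_factor A * unit_ball_vol CARD('n)"
proof -
  have "measure lborel (ellipsoid_at c A) = measure lebesgue ((\<lambda>x. 1 *\<^sub>R x + c) ` ((*v) A ` cball 0 1))"
    using borel_compact[OF compact_ellipsoid_at, of c A]
    by (simp add: ellipsoid_at_def image_image add.commute)
  also have "\<dots> = measure lebesgue ((*v) A ` cball 0 1)"
    by (subst measure_lebesgue_affine) simp
  also have "\<dots> = measure lborel ((*v) A ` cball 0 1)"
    by (rule measure_completion) (simp add: borel_compact compact_matrix_image)
  also have "\<dots> = vol_factor A * unit_ball_vol CARD('n)"
    by (subst measure_matrix_image) (auto simp: content_cball)
  finally show ?thesis .
qed

text \<open>Each entry of a matrix is a coordinate of the image of a basis vector.\<close>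

lemma bounded_matrices:
  assumes "\<And>A. A \<in> X \<Longrightarrow> \<forall>w\<in>cball 0 1. norm (A *v w) \<le> R"
  shows "bounded (X :: (real^'n^'n) set)"
proof -
  have "norm A \<le> real CARD('n) * (real CARD('n) * R)" if A: "A \<in> X" for A
  proof -
    have e: "\<bar>A $ i $ j\<bar> \<le> R" for i j
    proof -
      have "A $ i $ j = (A *v axis j 1) $ i" by (simp add: matrix_vector_mul_component inner_axis)
      also have "\<bar>\<dots>\<bar> \<le> norm (A *v axis j 1)" by (rule component_le_norm_cart)
      also have "\<dots> \<le> R" using assms[OF A] by (simp add: norm_axis_1)
      finally show ?thesis .
    qed
    have "norm A \<le> (\<Sum>i\<in>UNIV. norm (A $ i))" unfolding norm_vec_def by (rule L2_set_le_sum) simp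
    also have "\<dots> \<le> (\<Sum>i\<in>(UNIV::'n set). real CARD('n) * R)"
    proof (rule sum_mono)
      fix i
      have "norm (A $ i) \<le> (\<Sum>j\<in>UNIV. \<bar>A $ i $ j\<bar>)" by (rule norm_le_l1_cart)
      also have "\<dots> \<le> (\<Sum>j\<in>(UNIV::'n set). R)" by (intro sum_mono e)
      finally show "norm (A $ i) \<le> real CARD('n) * R" by simp
    qed
    finally show ?thesis by simp
  qed
  then show ?thesis unfolding bounded_iff by blast
qed

lemma integral_ellipsoid_fun:
  assumes "a > 0"
  shows "(\<integral>x. a * indicator (ellipsoid_at c A) x \<partial>lborel) = a * measure lborel (ellipsoid_at c A)"
  using borel_compact[OF compact_ellipsoid_at, of c A] emeasure_compact_finite[OF compact_ellipsoid_at, of c A]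
  by (subst integral_mult_right_zero) auto

text \<open>Ellipsoid functions whose height is below a threshold \<open>s\<close> have a smaller integral than a fixed candidate.
The others correspond to triples of height, centre and matrix in a closed set, which is bounded because the
superlevel set at height \<open>s\<close> is. On this compact set the continuous function height times volume
factor attains its maximum. The maximum is positive, so the maximizing matrix is invertible and the
maximizer is a genuine ellipsoid.\<close>

lemma john_ellipsoid_is_arg_max:
  fixes f :: "real^'n \<Rightarrow> real"
  assumes "integrable_log_concave f"
  shows "is_arg_max (\<lambda>g. \<integral>x. g x \<partial>lborel) (\<lambda>g. ellipsoid_fun g \<and> (\<forall>x. g x \<le> f x)) (john_ellipsoid f)"
proof -
  interpret integrable_log_concave f by fact
  define V where "V = unit_ball_vol (real CARD('n))"
  have V: "V > 0" by (simp add: V_def)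
  have int: "(\<integral>x. a * indicator (ellipsoid_at c A) x \<partial>lborel) = a * vol_factor A * V" if "a > 0" for a c and A :: "real^'n^'n"
    using integral_ellipsoid_fun[OF that, of c A] by (simp add: measure_ellipsoid_at V_def)
  have sub: "(\<forall>x. a * indicator (ellipsoid_at c A) x \<le> f x) \<longleftrightarrow> (\<forall>w\<in>cball 0 1. a \<le> f (c + A *v w))" if "a > 0" for a c A
    using that by (auto simp: ellipsoid_at_def indicator_def)
  obtain t z r where t: "t > 0" "r > 0" "\<And>x. x \<in> cball z r \<Longrightarrow> f x \<ge> t"
    using superlevel_contains_ball by blast
  define A0 where "A0 = r *\<^sub>R (mat 1 :: real^'n^'n)"
  have A0: "A0 *v w = r *\<^sub>R w" for w by (simp add: A0_def scaleR_matrix_vector_assoc[symmetric])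
  have "bij ((*v) A0)"
    using t(2) by (intro o_bij[of "\<lambda>x. (1 / r) *\<^sub>R x"]) (auto simp: A0 fun_eq_iff)
  then have dA0: "vol_factor A0 > 0" using vol_factor_pos_iff by blast
  have tA0: "\<forall>w\<in>cball 0 1. t \<le> f (z + A0 *v w)"
  proof
    fix w :: "real^'n" assume "w \<in> cball 0 1"
    then have "norm (r *\<^sub>R w) \<le> r * 1" using t(2) unfolding norm_scaleR by (intro mult_mono) auto
    then show "t \<le> f (z + A0 *v w)" by (intro t(3)) (simp add: A0 dist_norm)
  qed
  obtain s where s: "s > 0" "\<And>a S. 0 \<le> a \<Longrightarrow> a < s \<Longrightarrow> compact S \<Longrightarrow> (\<And>x. x \<in> S \<Longrightarrow> a \<le> f x) \<Longrightarrow> a * measure lborel S < t * vol_factor A0 * V"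
    using small_level_mass[of "t * vol_factor A0 * V"] t(1) dA0 V by (metis mult_pos_pos)
  have small: "a * vol_factor A * V < t * vol_factor A0 * V" if "0 < a" "a < s" "\<forall>w\<in>cball 0 1. a \<le> f (c + A *v w)" for a c A
  proof -
    have "a * measure lborel (ellipsoid_at c A) < t * vol_factor A0 * V"
      by (rule s(2)[OF _ that(2) compact_ellipsoid_at])
        (use that in \<open>auto simp: ellipsoid_at_def\<close>)
    then show ?thesis unfolding measure_ellipsoid_at V_def[symmetric] by (simp only: mult.assoc)
  qed
  have ts: "t \<ge> s" using small[OF t(1) _ tA0] by linarith
  define P where "P = {p :: real \<times> (real^'n) \<times> (real^'n^'n). s \<le> fst p} \<inter>
    (\<Inter>w\<in>cball 0 1. (\<lambda>p. (fst p, fst (snd p) + snd (snd p) *v w)) -` {(a, x). a \<le> f x})"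
  have Piff: "(a, c, A) \<in> P \<longleftrightarrow> s \<le> a \<and> (\<forall>w\<in>cball 0 1. a \<le> f (c + A *v w))" for a c A
    by (auto simp: P_def)
  have "closed P"
  proof -
    have "continuous_on UNIV (\<lambda>p::real \<times> (real^'n) \<times> (real^'n^'n). (fst p, fst (snd p) + snd (snd p) *v w))" for w
    proof -
      have "linear (\<lambda>A::real^'n^'n. A *v w)"
        by (intro linearI) (simp_all add: matrix_vector_mult_add_rdistrib scaleR_matrix_vector_assoc)
      then have "continuous_on UNIV (\<lambda>A::real^'n^'n. A *v w)"
        by (intro linear_continuous_on linear_conv_bounded_linear[THEN iffD1])
      then have "continuous_on UNIV (\<lambda>p::real \<times> (real^'n) \<times> (real^'n^'n). snd (snd p) *v w)"
        by (rule continuous_on_compose2) (auto intro!: continuous_intros)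
      then show ?thesis by (intro continuous_intros)
    qed
    then have "closed ((\<lambda>p::real \<times> (real^'n) \<times> (real^'n^'n). (fst p, fst (snd p) + snd (snd p) *v w)) -` {(a, x). a \<le> f x})" for w
      by (intro closed_vimage hypograph_closed)
    then show ?thesis unfolding P_def
      by (intro closed_Int closed_INT closed_Collect_le continuous_intros) auto
  qed
  moreover have "bounded P"
  proof -
    obtain R where R: "\<And>x. f x \<ge> s \<Longrightarrow> norm x \<le> R"
      using superlevel_bounded[OF s(1)] unfolding bounded_iff by blast
    have c: "norm c \<le> R" and A: "\<forall>w\<in>cball 0 1. norm (A *v w) \<le> 2 * R" and a: "\<bar>a\<bar> \<le> sup_norm f"
      if p: "(a, c, A) \<in> P" for a c A
    proof -
      have le: "norm (c + A *v w) \<le> R" if "w \<in> cball 0 1" for w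
        using p that by (intro R) (force simp: Piff)
      from le[of 0] show c: "norm c \<le> R" by simp
      show "\<forall>w\<in>cball 0 1. norm (A *v w) \<le> 2 * R"
      proof
        fix w :: "real^'n" assume "w \<in> cball 0 1"
        then have "norm (c + A *v w) \<le> R" by (rule le)
        then show "norm (A *v w) \<le> 2 * R" using c norm_triangle_ineq4[of "c + A *v w" c] by simp
      qed
      have "\<forall>w\<in>cball 0 1. a \<le> f (c + A *v w)" "s \<le> a" using p unfolding Piff by auto
      moreover from this(1) have "a \<le> f (c + A *v 0)" by (rule bspec) simp
      ultimately show "\<bar>a\<bar> \<le> sup_norm f" using le_sup_norm[of "c + A *v 0"] s(1) by linarith
    qed
    have "bounded {a::real. \<bar>a\<bar> \<le> sup_norm f}" unfolding bounded_iff by auto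
    moreover have "bounded {c::real^'n. norm c \<le> R}" unfolding bounded_iff by auto
    moreover have "bounded {A::real^'n^'n. \<forall>w\<in>cball 0 1. norm (A *v w) \<le> 2 * R}"
      by (rule bounded_matrices) auto
    ultimately have "bounded ({a::real. \<bar>a\<bar> \<le> sup_norm f} \<times> {c::real^'n. norm c \<le> R} \<times>
      {A::real^'n^'n. \<forall>w\<in>cball 0 1. norm (A *v w) \<le> 2 * R})" by (intro bounded_Times)
    then show ?thesis by (rule bounded_subset) (use c A a in auto)
  qed
  ultimately have "compact P" by (simp add: compact_eq_bounded_closed)
  moreover have P0: "(t, z, A0) \<in> P" using ts tA0 by (simp add: Piff)
  moreover have "continuous_on P (\<lambda>p. fst p * vol_factor (snd (snd p)))"
  proof -
    have "continuous_on P (\<lambda>p. vol_factor (snd (snd p)))"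
      by (rule continuous_on_compose2[OF continuous_on_vol_factor]) (auto intro!: continuous_intros)
    then show ?thesis by (intro continuous_intros)
  qed
  ultimately obtain p where p: "p \<in> P" "\<And>q. q \<in> P \<Longrightarrow> fst q * vol_factor (snd (snd q)) \<le> fst p * vol_factor (snd (snd p))"
    using continuous_attains_sup[of P "\<lambda>p. fst p * vol_factor (snd (snd p))"] by blast
  obtain a1 c1 A1 where p1: "p = (a1, c1, A1)" by (cases p)
  have a1: "s \<le> a1" "\<forall>w\<in>cball 0 1. a1 \<le> f (c1 + A1 *v w)" using p(1) unfolding p1 Piff by auto
  have a1pos: "a1 > 0" using a1(1) s(1) by linarith
  have max1: "a * vol_factor A \<le> a1 * vol_factor A1" if "(a, c, A) \<in> P" for a c A using p(2)[OF that] by (simp add: p1)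
  have "0 < t * vol_factor A0" using t(1) dA0 by simp
  also have "\<dots> \<le> a1 * vol_factor A1" by (rule max1[OF P0])
  finally have "vol_factor A1 > 0" using a1pos by (simp add: zero_less_mult_iff)
  then have bij1: "bij ((*v) A1)" using vol_factor_pos_iff by blast
  define g1 where "g1 = (\<lambda>x. a1 * indicator (ellipsoid_at c1 A1) x)"
  have g1: "ellipsoid_fun g1 \<and> (\<forall>x. g1 x \<le> f x)"
    using bij1 a1pos sub[OF a1pos] a1(2) unfolding ellipsoid_fun_def ellipsoid_iff g1_def by blast
  have "is_arg_max (\<lambda>g. \<integral>x. g x \<partial>lborel) (\<lambda>g. ellipsoid_fun g \<and> (\<forall>x. g x \<le> f x)) g1"
    unfolding is_arg_max_def
  proof (intro conjI g1 notI, elim exE conjE)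
    fix g assume g: "ellipsoid_fun g" "\<forall>x. g x \<le> f x" and less: "(\<integral>x. g1 x \<partial>lborel) < (\<integral>x. g x \<partial>lborel)"
    obtain a c A where gA: "a > 0" "g = (\<lambda>x. a * indicator (ellipsoid_at c A) x)"
      using g(1) unfolding ellipsoid_fun_def ellipsoid_iff by blast
    have aA: "\<forall>w\<in>cball 0 1. a \<le> f (c + A *v w)" using sub[OF gA(1)] g(2) gA(2) by blast
    have "a * vol_factor A * V \<le> a1 * vol_factor A1 * V"
    proof (cases "a < s")
      case True
      have "a * vol_factor A * V \<le> t * vol_factor A0 * V" using small[OF gA(1) True aA] by simp
      also have "\<dots> \<le> a1 * vol_factor A1 * V" using max1[OF P0] V by (intro mult_right_mono) auto
      finally show ?thesis .
    next
      case False
      then have "(a, c, A) \<in> P" using aA by (simp add: Piff)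
      from max1[OF this] show ?thesis using V by (intro mult_right_mono) auto
    qed
    then show False using less unfolding g1_def gA(2) int[OF a1pos] int[OF gA(1)] by linarith
  qed
  then show ?thesis
    unfolding john_ellipsoid_def arg_max_def
    using someI[of "is_arg_max (\<lambda>g. \<integral>x. g x \<partial>lborel) (\<lambda>g. ellipsoid_fun g \<and> (\<forall>x. g x \<le> f x))" g1]
    by (simp only:)
qed

section \<open>Weak gradients\<close>

lemma smooth_funs_measurable [measurable_dest]: "p \<in> smooth_funs \<Longrightarrow> p \<in> borel_measurable borel"
  by (intro borel_measurable_continuous_onI smooth_funs_continuous)

lemma smooth_funs_bounded:
  assumes "p \<in> smooth_funs" "\<And>x. norm x \<ge> R \<Longrightarrow> p x = 0"
  obtains C where "C \<ge> 0" "\<And>x. \<bar>p x\<bar> \<le> C"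
proof -
  have "bounded (p ` cball 0 R)"
    by (intro compact_imp_bounded compact_continuous_image smooth_funs_continuous assms(1) compact_cball)
  then obtain C where "\<forall>y\<in>p ` cball 0 R. norm y \<le> C" unfolding bounded_iff by blast
  then have C: "\<bar>p x\<bar> \<le> C" if "x \<in> cball 0 R" for x using that by simp
  show thesis
  proof (rule that[of "max 0 C"])
    fix x show "\<bar>p x\<bar> \<le> max 0 C"
      using C[of x] assms(2)[of x] by (cases "norm x \<le> R") auto
  qed simp
qed

lemma smooth_funs_partial_outside:
  assumes "p \<in> smooth_funs" "\<And>x. norm x \<ge> R \<Longrightarrow> p x = 0" "norm x > R"
  shows "frechet_derivative p (at x) h = 0"
proof -
  have "((\<lambda>x. 0) has_derivative (\<lambda>h. 0)) (at x)" by simp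
  then have "(p has_derivative (\<lambda>h. 0)) (at x)"
  proof (rule has_derivative_transform_within_open)
    show "open {x. norm x > R}" by (intro open_Collect_less continuous_intros)
  qed (use assms in auto)
  then show ?thesis by (metis frechet_derivative_at)
qed

lemma integrable_mult_smooth:
  fixes g :: "'a::euclidean_space \<Rightarrow> real"
  assumes "integrable lborel g" "p \<in> smooth_funs" "\<And>x. norm x \<ge> R \<Longrightarrow> p x = 0"
  shows "integrable lborel (\<lambda>x. g x * p x)"
proof -
  obtain C where C: "C \<ge> 0" "\<And>x. \<bar>p x\<bar> \<le> C" using smooth_funs_bounded[OF assms(2,3)] by blast
  have [measurable]: "p \<in> borel_measurable borel" using assms(2) by (rule smooth_funs_measurable)
  have [measurable]: "g \<in> borel_measurable borel" using borel_measurable_integrable[OF assms(1)] by simp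
  show ?thesis
  proof (rule Bochner_Integration.integrable_bound)
    show "integrable lborel (\<lambda>x. C * \<bar>g x\<bar>)" using assms(1) by simp
    show "AE x in lborel. norm (g x * p x) \<le> norm (C * \<bar>g x\<bar>)"
    proof (rule AE_I2)
      fix x
      have "\<bar>g x\<bar> * \<bar>p x\<bar> \<le> \<bar>g x\<bar> * C" by (intro mult_left_mono C(2)) simp
      then show "norm (g x * p x) \<le> norm (C * \<bar>g x\<bar>)" using C(1) by (simp add: abs_mult mult.commute)
    qed
  qed measurable
qed

lemma frechet_derivative_sum_Basis:
  assumes "p \<in> smooth_funs"
  shows "frechet_derivative p (at x) v = (\<Sum>b\<in>Basis. (v \<bullet> b) * frechet_derivative p (at x) b)"
proof -
  have lin: "linear (frechet_derivative p (at x))"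
    using smooth_funs_has_derivative[OF assms] has_derivative_linear by blast
  have "frechet_derivative p (at x) v = frechet_derivative p (at x) (\<Sum>b\<in>Basis. (v \<bullet> b) *\<^sub>R b)"
    by (simp add: euclidean_representation)
  also have "\<dots> = (\<Sum>b\<in>Basis. (v \<bullet> b) * frechet_derivative p (at x) b)"
    using lin by (simp add: linear_sum linear_cmul)
  finally show ?thesis .
qed

text \<open>The definition of the weak gradient, summed over the components of the vector field
\<open>y \<mapsto> p y A (y - c)\<close>, whose divergence is the integrand on the left.\<close>

lemma has_L1_gradient_divergence:
  fixes f :: "'a::euclidean_space \<Rightarrow> real"
  assumes f: "integrable lborel f" and G: "has_L1_gradient f G" and A: "linear A"
    and p: "p \<in> smooth_funs" "\<And>x. norm x \<ge> R \<Longrightarrow> p x = 0"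
  shows "(\<integral>y. f y * (frechet_derivative p (at y) (A (y - c)) + (\<Sum>b\<in>Basis. A b \<bullet> b) * p y) \<partial>lborel)
    = - (\<integral>y. (G y \<bullet> A (y - c)) * p y \<partial>lborel)"
proof -
  define q where "q b y = p y * (A (y - c) \<bullet> b)" for b y
  have lin: "(\<lambda>y. A (y - c) \<bullet> b) \<in> smooth_funs" for b
  proof -
    have "linear (\<lambda>y. A y \<bullet> b)"
      using A by (auto intro!: linearI simp: linear_add linear_cmul inner_add_left)
    then have "(\<lambda>y. A y \<bullet> b + (- (A c \<bullet> b))) \<in> smooth_funs"
      by (intro smooth_funs.add smooth_funs.const linear_in_smooth_funs)
    then show ?thesis using A by (simp add: linear_diff inner_diff_left)
  qed
  have q: "q b \<in> smooth_funs" for b unfolding q_def using p(1) lin by (intro smooth_funs.mult)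
  have q0: "q b y = 0" if "norm y \<ge> R" for b y using p(2)[OF that] by (simp add: q_def)
  have dq: "frechet_derivative (q b) (at y) b = p y * (A b \<bullet> b) + frechet_derivative p (at y) b * (A (y - c) \<bullet> b)" for b y
  proof -
    have "((\<lambda>y. A (y - c) \<bullet> b) has_derivative (\<lambda>h. A h \<bullet> b)) (at y)"
      using A linear_conv_bounded_linear[of A]
      by (auto intro!: derivative_eq_intros bounded_linear.has_derivative[of A])
    from has_derivative_mult[OF smooth_funs_has_derivative[OF p(1)] this]
    have "(q b has_derivative (\<lambda>h. p y * (A h \<bullet> b) + frechet_derivative p (at y) h * (A (y - c) \<bullet> b))) (at y)"
      unfolding q_def .
    from frechet_derivative_at[OF this] show ?thesis by metis
  qed
  have int1: "integrable lborel (\<lambda>y. f y * frechet_derivative (q b) (at y) b)" for b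
    by (intro integrable_mult_smooth[where R = "R + 1"] f smooth_funs_partial q
        smooth_funs_partial_outside[OF q q0]) auto
  have int2: "integrable lborel (\<lambda>y. (G y \<bullet> b) * q b y)" for b
    using G unfolding has_L1_gradient_def
    by (intro integrable_mult_smooth[OF _ q q0] integrable_inner_left) auto
  have "f y * (frechet_derivative p (at y) (A (y - c)) + (\<Sum>b\<in>Basis. A b \<bullet> b) * p y)
      = (\<Sum>b\<in>Basis. f y * frechet_derivative (q b) (at y) b)" for y
    unfolding frechet_derivative_sum_Basis[OF p(1), of y "A (y - c)"] dq
    by (simp add: sum_distrib_left sum_distrib_right sum.distrib algebra_simps)
  then have "(\<integral>y. f y * (frechet_derivative p (at y) (A (y - c)) + (\<Sum>b\<in>Basis. A b \<bullet> b) * p y) \<partial>lborel)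
    = (\<Sum>b\<in>Basis. \<integral>y. f y * frechet_derivative (q b) (at y) b \<partial>lborel)"
    using int1 by (simp add: Bochner_Integration.integral_sum)
  also have "\<dots> = (\<Sum>b\<in>Basis. - (\<integral>y. (G y \<bullet> b) * q b y \<partial>lborel))"
    using G test_fun_smooth[OF q q0] unfolding has_L1_gradient_def by (intro sum.cong) auto
  also have "\<dots> = - (\<integral>y. (\<Sum>b\<in>Basis. (G y \<bullet> b) * q b y) \<partial>lborel)"
    using int2 by (simp add: Bochner_Integration.integral_sum sum_negf)
  also have "(\<lambda>y. \<Sum>b\<in>Basis. (G y \<bullet> b) * q b y) = (\<lambda>y. (G y \<bullet> A (y - c)) * p y)"
    unfolding q_def euclidean_inner[of "G _" "A (_ - c)"] by (simp only: sum_distrib_right) (simp add: mult_ac)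
  finally show ?thesis .
qed

text \<open>The set where \<open>F < 0\<close>, cut to a ball, has an indicator that is an almost everywhere limit of
continuous functions. Their square roots are approximated by polynomials; squaring and multiplying with a
bump function yields nonnegative test functions converging to the indicator times the bump, so \<open>F\<close> has a
nonnegative integral over a set on which it is negative.\<close>

lemma AE_nonneg_if_weakly_nonneg:
  fixes F :: "'a::euclidean_space \<Rightarrow> real"
  assumes [measurable]: "F \<in> borel_measurable borel"
    and int: "\<And>R. R > 0 \<Longrightarrow> integrable lborel (\<lambda>x. F x * bump R x)"
    and weak: "\<And>p R. p \<in> smooth_funs \<Longrightarrow> (\<And>x. p x \<ge> 0) \<Longrightarrow> (\<And>x. norm x \<ge> R \<Longrightarrow> p x = 0) \<Longrightarrow> (\<integral>x. F x * p x \<partial>lborel) \<ge> 0"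
  shows "AE x in lborel. F x \<ge> 0"
proof -
  have "AE x in lborel. norm x \<le> r \<longrightarrow> F x \<ge> 0" if r: "r \<ge> 0" for r
  proof -
    define A where "A = {x. F x < 0} \<inter> cball 0 r"
    have [measurable]: "cball (0::'a) r \<in> sets borel" by simp
    have [measurable]: "A \<in> sets borel" unfolding A_def by measurable
    have [measurable]: "bump (r + 1) \<in> borel_measurable (borel :: 'a measure)"
      by (intro smooth_funs_measurable bump_in_smooth_funs)
    have "(indicator A :: 'a \<Rightarrow> real) \<in> borel_measurable lebesgue"
      by (intro borel_measurable_indicator) (simp add: sets_completionI_sets)
    then have "(indicator A :: 'a \<Rightarrow> real) measurable_on UNIV"
      by (rule lebesgue_measurable_imp_measurable_on_real) simp
    then obtain Z g where Z: "negligible Z" and g: "\<And>n. continuous_on UNIV (g n)"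
      "\<And>x. x \<notin> Z \<Longrightarrow> (\<lambda>n. g n x) \<longlonglongrightarrow> (indicator A x :: real)"
      unfolding measurable_on_def by auto
    \<comment> \<open>Clamping to the unit interval keeps the approximations dominated; the root is taken because the polynomials are squared.\<close>
    define k where "k n x = sqrt (max 0 (min 1 (g n x)))" for n x
    have k: "continuous_on S (k n)" for n S
      unfolding k_def by (intro continuous_intros continuous_on_subset[OF g(1)]) auto
    have "\<exists>p. real_polynomial_function p \<and> (\<forall>x\<in>cball 0 (r + 1). \<bar>k n x - p x\<bar> < 1 / Suc n)" for n
      using Stone_Weierstrass_real_polynomial_function[OF compact_cball k, of "1 / Suc n" 0 "r + 1"]
      by (metis of_nat_0_less_iff zero_less_Suc zero_less_divide_1_iff)
    then obtain p where p: "\<And>n. real_polynomial_function (p n)"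
      "\<And>n x. x \<in> cball 0 (r + 1) \<Longrightarrow> \<bar>k n x - p n x\<bar> < 1 / Suc n" by metis
    define q where "q n x = (p n x * p n x) * bump (r + 1) x" for n x
    have q: "q n \<in> smooth_funs" for n
      unfolding q_def
      by (intro smooth_funs.mult bump_in_smooth_funs real_polynomial_function_in_smooth_funs p(1))
    have q0: "q n x \<ge> 0" for n x using bump_nonneg[of "r + 1" x] by (simp add: q_def)
    have qz: "q n x = 0" if "norm x \<ge> r + 1" for n x using bump_zero[of "r + 1" x] that r by (simp add: q_def)
    have le: "q n x \<le> 4 * bump (r + 1) x" for n x
    proof (cases "norm x \<ge> r + 1")
      case True
      then show ?thesis using qz[OF True] bump_nonneg[of "r + 1" x] by simp
    next
      case False
      have "0 \<le> k n x" "k n x \<le> 1" unfolding k_def by auto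
      moreover have "\<bar>k n x - p n x\<bar> < 1 / Suc n" using False by (intro p(2)) auto
      moreover have "1 / Suc n \<le> (1::real)" by simp
      ultimately have "\<bar>p n x\<bar> \<le> 2" by linarith
      then have "\<bar>p n x\<bar> * \<bar>p n x\<bar> \<le> 2 * 2" by (intro mult_mono) auto
      then have "p n x * p n x \<le> 4" by (simp flip: abs_mult)
      then show ?thesis unfolding q_def by (intro mult_right_mono bump_nonneg)
    qed
    have lim: "(\<lambda>n. q n x) \<longlonglongrightarrow> indicator A x * bump (r + 1) x" if "x \<notin> Z" for x
    proof (cases "norm x \<ge> r + 1")
      case True
      then show ?thesis using r by (simp add: qz bump_zero)
    next
      case False
      have "(\<lambda>n. k n x) \<longlonglongrightarrow> sqrt (max 0 (min 1 (indicator A x)))"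
        unfolding k_def by (intro tendsto_intros g(2) that)
      also have "sqrt (max 0 (min 1 (indicator A x))) = indicator A x" by (simp add: indicator_def)
      finally have kl: "(\<lambda>n. k n x) \<longlonglongrightarrow> indicator A x" .
      have "(\<lambda>n. k n x - p n x) \<longlonglongrightarrow> 0"
      proof (rule Lim_null_comparison)
        show "\<forall>\<^sub>F n in sequentially. norm (k n x - p n x) \<le> 1 / Suc n"
          unfolding real_norm_def using False by (intro always_eventually allI less_imp_le[OF p(2)]) auto
        show "(\<lambda>n. 1 / real (Suc n)) \<longlonglongrightarrow> 0" by (rule LIMSEQ_Suc[OF lim_1_over_n])
      qed
      from tendsto_diff[OF kl this] have "(\<lambda>n. p n x) \<longlonglongrightarrow> indicator A x" by simp
      then have "(\<lambda>n. q n x) \<longlonglongrightarrow> (indicator A x * indicator A x) * bump (r + 1) x"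
        unfolding q_def by (intro tendsto_intros)
      then show ?thesis by (cases "x \<in> A") simp_all
    qed
    have "AE x in lebesgue. x \<notin> Z"
      using Z by (intro AE_not_in) (simp only: negligible_iff_null_sets)
    then have AEZ: "AE x in lborel. x \<notin> Z" by (simp only: AE_completion_iff)
    have "(\<lambda>n. \<integral>x. F x * q n x \<partial>lborel) \<longlonglongrightarrow> (\<integral>x. F x * (indicator A x * bump (r + 1) x) \<partial>lborel)"
    proof (rule integral_dominated_convergence[where w = "\<lambda>x. 4 * \<bar>F x * bump (r + 1) x\<bar>"])
      show "AE x in lborel. (\<lambda>n. F x * q n x) \<longlonglongrightarrow> F x * (indicator A x * bump (r + 1) x)"
        using AEZ by eventually_elim (intro tendsto_intros lim)
      show "AE x in lborel. norm (F x * q n x) \<le> 4 * \<bar>F x * bump (r + 1) x\<bar>" for n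
      proof (intro AE_I2)
        fix x
        have "\<bar>F x\<bar> * q n x \<le> \<bar>F x\<bar> * (4 * bump (r + 1) x)" by (intro mult_left_mono le) auto
        then show "norm (F x * q n x) \<le> 4 * \<bar>F x * bump (r + 1) x\<bar>"
          using q0[of n x] bump_nonneg[of "r + 1" x] by (simp add: abs_mult)
      qed
      show "integrable lborel (\<lambda>x. 4 * \<bar>F x * bump (r + 1) x\<bar>)" using int[of "r + 1"] r by simp
    qed (use smooth_funs_measurable[OF q] in measurable)
    then have ge: "(\<integral>x. F x * (indicator A x * bump (r + 1) x) \<partial>lborel) \<ge> 0"
      by (rule LIMSEQ_le_const) (use weak[OF q q0 qz] in blast)
    let ?u = "\<lambda>x. - (F x * (indicator A x * bump (r + 1) x))"
    have u: "?u x \<ge> 0" for x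
      using bump_nonneg[of "r + 1" x] by (auto simp: A_def indicator_def mult_nonpos_nonneg)
    have intu: "integrable lborel ?u"
    proof (rule Bochner_Integration.integrable_bound)
      show "integrable lborel (\<lambda>x. F x * bump (r + 1) x)" using int[of "r + 1"] r by simp
      show "AE x in lborel. norm (?u x) \<le> norm (F x * bump (r + 1) x)"
        by (intro AE_I2) (auto simp: indicator_def)
    qed measurable
    have "(\<integral>x. ?u x \<partial>lborel) = 0"
    proof (rule antisym)
      show "(\<integral>x. ?u x \<partial>lborel) \<le> 0" using ge by simp
      show "0 \<le> (\<integral>x. ?u x \<partial>lborel)" by (intro integral_nonneg_AE AE_I2 u)
    qed
    then have "AE x in lborel. ?u x = 0"
      using integral_nonneg_eq_0_iff_AE[OF intu] u by simp
    then show ?thesis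
    proof eventually_elim
      case (elim x)
      show ?case
      proof (intro impI, rule ccontr)
        assume "norm x \<le> r" "\<not> 0 \<le> F x"
        moreover from this have "bump (r + 1) x > 0" using r by (intro bump_pos) auto
        ultimately show False using elim by (auto simp: A_def indicator_def)
      qed
    qed
  qed
  then have "AE x in lborel. \<forall>n::nat. norm x \<le> real n \<longrightarrow> F x \<ge> 0"
    by (subst AE_all_countable) simp
  then show ?thesis
  proof eventually_elim
    case (elim x)
    then show ?case using real_arch_simple[of "norm x"] by blast
  qed
qed

section \<open>The support inequality\<close>

text \<open>The partial derivatives are smooth with compact support, hence bounded.\<close>

lemma smooth_funs_lipschitz:
  fixes p :: "'a::euclidean_space \<Rightarrow> real"
  assumes p: "p \<in> smooth_funs" "\<And>x. norm x \<ge> R \<Longrightarrow> p x = 0"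
  obtains L where "L \<ge> 0" "\<And>x y. \<bar>p x - p y\<bar> \<le> L * norm (x - y)"
proof -
  have "\<exists>C. C \<ge> 0 \<and> (\<forall>x. \<bar>frechet_derivative p (at x) b\<bar> \<le> C)" for b
    using smooth_funs_bounded[OF smooth_funs_partial[OF p(1)], of "R + 1" b] smooth_funs_partial_outside[OF p]
    by (metis less_add_one less_le_trans)
  then obtain C where C: "\<And>b. C b \<ge> 0" "\<And>b x. \<bar>frechet_derivative p (at x) b\<bar> \<le> C b" by metis
  define L where "L = (\<Sum>b\<in>(Basis::'a set). C b)"
  have L: "L \<ge> 0" unfolding L_def using C(1) by (intro sum_nonneg) auto
  have bd: "\<bar>frechet_derivative p (at x) v\<bar> \<le> L * norm v" for x v
  proof -
    have "\<bar>frechet_derivative p (at x) v\<bar> \<le> (\<Sum>b\<in>Basis. \<bar>(v \<bullet> b) * frechet_derivative p (at x) b\<bar>)"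
      unfolding frechet_derivative_sum_Basis[OF p(1), of x v] by (rule sum_abs)
    also have "\<dots> \<le> (\<Sum>b\<in>Basis. norm v * C b)"
      using C by (intro sum_mono) (auto simp: abs_mult Basis_le_norm intro!: mult_mono)
    also have "\<dots> = L * norm v" by (simp add: L_def sum_distrib_left mult.commute)
    finally show ?thesis .
  qed
  show thesis
  proof (rule that[OF L])
    fix x y
    have "norm (p x - p y) \<le> L * norm (x - y)"
    proof (rule differentiable_bound[OF convex_UNIV])
      show "(p has_derivative frechet_derivative p (at x)) (at x within UNIV)" for x
        using smooth_funs_has_derivative[OF p(1)] by simp
      show "onorm (frechet_derivative p (at x)) \<le> L" for x
        using bd by (intro onorm_le) simp
    qed auto
    then show "\<bar>p x - p y\<bar> \<le> L * norm (x - y)" by simp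
  qed
qed

context integrable_log_concave
begin

text \<open>The tangent inequality for the convex exponent in a form without derivatives. It combines log-concavity
with \<open>exp u \<ge> 1 + u\<close>.\<close>

lemma shrink_difference_ge:
  assumes a: "0 < a" "a \<le> f e" and s: "0 < s" "s < 1"
  shows "f ((1 - s) *\<^sub>R x + s *\<^sub>R e) - f x \<ge> - s * (f x * ln (f x / a))"
proof (cases "f x = 0")
  case False
  then have fx: "f x > 0" using nonneg[of x] by linarith
  have "f x * (1 + s * ln (a / f x)) \<le> f x * exp (s * ln (a / f x))"
    using fx by (intro mult_left_mono) auto
  also have "\<dots> = f x powr (1 - s) * a powr s"
    using fx a(1) by (simp add: powr_def ln_div exp_diff exp_add algebra_simps flip: exp_add)
  also have "\<dots> \<le> f x powr (1 - s) * f e powr s"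
    using a s by (intro mult_left_mono powr_mono2) auto
  also have "\<dots> \<le> f ((1 - s) *\<^sub>R x + s *\<^sub>R e)" by (rule log_concave_ineq[OF log_concave s])
  finally show ?thesis using fx a(1) by (simp add: ln_div algebra_simps)
qed simp

text \<open>The difference quotient of the dilated test function is bounded uniformly in \<open>y\<close> and \<open>s\<close>: near the support
by the Lipschitz constant, and it vanishes where \<open>y\<close> is far out because the map
\<open>y \<mapsto> y + (s / (1 - s)) (y - e)\<close> then moves points further out. This provides the dominating function.\<close>

lemma shrink_quotient_bound:
  fixes p :: "'a \<Rightarrow> real"
  assumes p: "\<And>x. norm x \<ge> R \<Longrightarrow> p x = 0" "\<And>x. \<bar>p x\<bar> \<le> B" "\<And>x y. \<bar>p x - p y\<bar> \<le> L * norm (x - y)"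
    and L: "L \<ge> 0" and s: "0 < s" "s \<le> 1 / 2"
  shows "\<bar>((1 / (1 - s)) ^ n * p (y + (s / (1 - s)) *\<^sub>R (y - e)) - p y) / s\<bar>
    \<le> 2 ^ n * (4 * L * max \<bar>R\<bar> (norm e)) + 2 ^ n * n * B"
proof -
  define M where "M = max \<bar>R\<bar> (norm e)"
  define u where "u = s / (1 - s)"
  define m where "m = (1 / (1 - s)) ^ n"
  have M: "M \<ge> 0" "\<bar>R\<bar> \<le> M" "norm e \<le> M" by (auto simp: M_def)
  have B: "B \<ge> 0" using p(2)[of 0] by linarith
  have u: "0 \<le> u" "u \<le> 2 * s" using s by (auto simp: u_def field_simps)
  have m: "0 \<le> m" "m \<le> 2 ^ n"
    using s power_mono[of "1 / (1 - s)" 2 n] unfolding m_def by (auto simp: pos_divide_le_eq)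
  have ml: "0 \<le> m - 1" "m - 1 \<le> 2 ^ n * (n * s)"
  proof -
    have "1 \<le> 1 / (1 - s)" using s by (simp add: field_simps)
    then show "0 \<le> m - 1" unfolding m_def using one_le_power by auto
    have "1 + real n * (- s) \<le> (1 + (- s)) ^ n" using s by (intro Bernoulli_inequality) auto
    then have "1 - (1 - s) ^ n \<le> n * s" by simp
    then have "m * (1 - (1 - s) ^ n) \<le> 2 ^ n * (n * s)"
      using m s by (intro mult_mono) (auto simp: power_le_one)
    moreover have "m * (1 - s) ^ n = 1" using s by (simp add: m_def flip: power_mult_distrib)
    ultimately show "m - 1 \<le> 2 ^ n * (n * s)" by (simp add: algebra_simps)
  qed
  have "\<bar>m * p (y + u *\<^sub>R (y - e)) - p y\<bar> \<le> s * (2 ^ n * (4 * L * M) + 2 ^ n * n * B)"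
  proof (cases "norm y \<ge> M")
    case True
    have "norm (y + u *\<^sub>R (y - e)) \<ge> norm ((1 + u) *\<^sub>R y) - norm (u *\<^sub>R e)"
      using norm_triangle_ineq2[of "(1 + u) *\<^sub>R y" "u *\<^sub>R e"] by (simp add: algebra_simps)
    moreover have "norm ((1 + u) *\<^sub>R y) = norm y + u * norm y"
      using u(1) unfolding norm_scaleR by (simp add: distrib_right)
    moreover have "norm (u *\<^sub>R e) \<le> u * norm y" using u True M by (simp add: mult_left_mono)
    ultimately have "norm (y + u *\<^sub>R (y - e)) \<ge> R" using True M by linarith
    moreover have "norm y \<ge> R" using True M by linarith
    ultimately show ?thesis using p(1) s L M B by simp
  next
    case False
    have "\<bar>m * p (y + u *\<^sub>R (y - e)) - p y\<bar> = \<bar>m * (p (y + u *\<^sub>R (y - e)) - p y) + (m - 1) * p y\<bar>"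
      by (simp add: algebra_simps)
    also have "\<dots> \<le> m * \<bar>p (y + u *\<^sub>R (y - e)) - p y\<bar> + (m - 1) * \<bar>p y\<bar>"
      using m ml by (intro order_trans[OF abs_triangle_ineq]) (simp add: abs_mult)
    also have "\<dots> \<le> 2 ^ n * (L * ((2 * s) * (2 * M))) + (2 ^ n * (n * s)) * B"
    proof (intro add_mono mult_mono)
      have "norm (y - e) \<le> 2 * M" using norm_triangle_ineq4[of y e] False M by linarith
      then have "norm (u *\<^sub>R (y - e)) \<le> (2 * s) * (2 * M)"
        unfolding norm_scaleR using u s by (intro mult_mono) auto
      then have "L * norm (u *\<^sub>R (y - e)) \<le> L * ((2 * s) * (2 * M))" by (intro mult_left_mono L)
      then show "\<bar>p (y + u *\<^sub>R (y - e)) - p y\<bar> \<le> L * ((2 * s) * (2 * M))"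
        using p(3)[of "y + u *\<^sub>R (y - e)" y] by simp
    qed (use m ml p(2) s B in auto)
    also have "\<dots> = s * (2 ^ n * (4 * L * M) + 2 ^ n * n * B)" by (simp add: algebra_simps)
    finally show ?thesis .
  qed
  then show ?thesis using s unfolding m_def u_def M_def by (simp add: pos_divide_le_eq abs_divide mult.commute)
qed

lemma shrink_quotient_tendsto:
  fixes p :: "'a \<Rightarrow> real"
  assumes p: "p \<in> smooth_funs"
  shows "((\<lambda>s. ((1 / (1 - s)) ^ n * p (y + (s / (1 - s)) *\<^sub>R (y - e)) - p y) / s)
    \<longlongrightarrow> frechet_derivative p (at y) (y - e) + n * p y) (at 0)"
proof -
  let ?d = "frechet_derivative p (at y)"
  have lin: "linear ?d" using smooth_funs_has_derivative[OF p] has_derivative_linear by blast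
  have 1: "((\<lambda>s::real. y + (s / (1 - s)) *\<^sub>R (y - e)) has_derivative (\<lambda>h. h *\<^sub>R (y - e))) (at 0)"
    by (auto intro!: derivative_eq_intros simp: scaleR_left_diff_distrib)
  have "(p has_derivative ?d) (at (y + (0 / (1 - 0)) *\<^sub>R (y - e)))"
    using smooth_funs_has_derivative[OF p, of y] by simp
  from has_derivative_compose[OF 1 this]
  have 2: "((\<lambda>s. p (y + (s / (1 - s)) *\<^sub>R (y - e))) has_real_derivative ?d (y - e)) (at 0)"
    unfolding has_field_derivative_def using lin by (simp add: linear_cmul mult.commute[of _ "?d (y - e)"] cong: if_cong)
  have 3: "((\<lambda>s::real. (1 / (1 - s)) ^ n) has_real_derivative n) (at 0)"
    by (auto intro!: derivative_eq_intros)
  from DERIV_mult[OF 3 2]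
  have "((\<lambda>s. (1 / (1 - s)) ^ n * p (y + (s / (1 - s)) *\<^sub>R (y - e))) has_real_derivative ?d (y - e) + n * p y) (at 0)"
    by (simp add: add.commute)
  then show ?thesis unfolding DERIV_def by simp
qed

text \<open>The preceding difference inequality is tested with \<open>p\<close>. Substituting \<open>y = (1 - s) x + s e\<close> transfers the
dilation from \<open>f\<close> to \<open>p\<close>, where the limit \<open>s \<longlongrightarrow> 0\<close> exists and yields the divergence of \<open>(y - e) p y\<close>.\<close>

lemma weak_support_inequality:
  fixes p :: "'a \<Rightarrow> real"
  assumes a: "0 < a" "a \<le> f e"
    and p: "p \<in> smooth_funs" "\<And>x. norm x \<ge> R \<Longrightarrow> p x = 0" "\<And>x. p x \<ge> 0"
  shows "(\<integral>y. f y * (frechet_derivative p (at y) (y - e) + DIM('a) * p y) \<partial>lborel)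
    \<ge> - (\<integral>y. f y * ln (f y / a) * p y \<partial>lborel)"
proof -
  let ?n = "DIM('a)"
  \<comment> \<open>A null sequence that stays at most 1/2, where the uniform bound applies.\<close>
  define s where "s k = 1 / (real k + 2)" for k
  have s: "0 < s k" "s k \<le> 1 / 2" "s k < 1" for k by (auto simp: s_def field_simps)
  define D where "D k y = ((1 / (1 - s k)) ^ ?n * p (y + (s k / (1 - s k)) *\<^sub>R (y - e)) - p y) / s k" for k y
  obtain B where B: "B \<ge> 0" "\<And>x. \<bar>p x\<bar> \<le> B" using smooth_funs_bounded[OF p(1,2)] by blast
  obtain L where L: "L \<ge> 0" "\<And>x y. \<bar>p x - p y\<bar> \<le> L * norm (x - y)" using smooth_funs_lipschitz[OF p(1,2)] by blast
  have [measurable]: "p \<in> borel_measurable borel" using p(1) by (rule smooth_funs_measurable)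
  define C where "C = 2 ^ ?n * (4 * L * max \<bar>R\<bar> (norm e)) + 2 ^ ?n * real ?n * B"
  have DC: "\<bar>D k y\<bar> \<le> C" for k y
    unfolding D_def C_def by (rule shrink_quotient_bound[OF p(2) B(2) L(2) L(1) s(1,2)])
  have Dlim: "(\<lambda>k. D k y) \<longlonglongrightarrow> frechet_derivative p (at y) (y - e) + ?n * p y" for y
  proof -
    have "s \<longlonglongrightarrow> 0" unfolding s_def 
      using LIMSEQ_ignore_initial_segment[OF lim_1_over_n[where 'a = real], of 2] by (simp add: add.commute)
    then have "filterlim s (at 0) sequentially"
      using s(1) by (intro filterlim_atI always_eventually allI) (auto dest: less_imp_neq[symmetric])
    from filterlim_compose[OF shrink_quotient_tendsto[OF p(1)] this] show ?thesis unfolding D_def .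
  qed
  have intfp: "integrable lborel (\<lambda>x. f x * p x)" by (rule integrable_mult_smooth[OF integrable p(1,2)])
  have intfl: "integrable lborel (\<lambda>x. f x * ln (f x / a) * p x)"
    by (rule integrable_mult_smooth[OF f_ln_integrable[OF a(1)] p(1,2)])
  have ge: "(\<integral>y. f y * D k y \<partial>lborel) \<ge> - (\<integral>y. f y * ln (f y / a) * p y \<partial>lborel)" for k
  proof -
    let ?s = "s k"
    have aff: "(1 / (1 - ?s)) *\<^sub>R (y - ?s *\<^sub>R e) = y + (?s / (1 - ?s)) *\<^sub>R (y - e)" for y
    proof -
      have "(1 / (1 - ?s)) *\<^sub>R (y - ?s *\<^sub>R e) = (1 + ?s / (1 - ?s)) *\<^sub>R y - (?s / (1 - ?s)) *\<^sub>R e"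
        using s(3)[of k] by (simp add: scaleR_diff_right field_simps)
      then show ?thesis by (simp add: algebra_simps)
    qed
    define h where "h y = f y * p (y + (?s / (1 - ?s)) *\<^sub>R (y - e))" for y
    have [measurable]: "h \<in> borel_measurable borel" unfolding h_def by measurable
    have hx: "h (?s *\<^sub>R e + (1 - ?s) *\<^sub>R x) = f ((1 - ?s) *\<^sub>R x + ?s *\<^sub>R e) * p x" for x
      using s(3)[of k] unfolding h_def aff[symmetric] by (simp add: add.commute)
    have inth: "integrable lborel h"
    proof (rule Bochner_Integration.integrable_bound)
      show "integrable lborel (\<lambda>x. B * f x)" using integrable by simp
      show "AE x in lborel. norm (h x) \<le> norm (B * f x)"
        using mult_left_mono[OF B(2) nonneg] B(1)
        by (intro AE_I2) (simp add: h_def abs_mult mult.commute[of B])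
    qed measurable
    have int2: "integrable lborel (\<lambda>x. f ((1 - ?s) *\<^sub>R x + ?s *\<^sub>R e) * p x)"
      using lborel_integrable_affine[OF inth, of "1 - ?s" "?s *\<^sub>R e"] s(3)[of k] by (simp add: hx)
    have eq: "(\<integral>x. f ((1 - ?s) *\<^sub>R x + ?s *\<^sub>R e) * p x \<partial>lborel) = (1 / (1 - ?s)) ^ ?n * (\<integral>y. h y \<partial>lborel)"
    proof -
      have "(\<integral>y. h y \<partial>lborel) = \<bar>1 - ?s\<bar> ^ ?n * (\<integral>x. h (?s *\<^sub>R e + (1 - ?s) *\<^sub>R x) \<partial>lborel)"
        using s(3)[of k] by (intro lborel_integral_affine) auto
      then show ?thesis unfolding hx using s(3)[of k] by (simp add: power_one_over)
    qed
    have "- (\<integral>y. f y * ln (f y / a) * p y \<partial>lborel) = (\<integral>y. (- ?s * (f y * ln (f y / a))) * p y / ?s \<partial>lborel)"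
      using s(1)[of k] by (simp add: mult.assoc)
    also have "\<dots> \<le> (\<integral>y. (f ((1 - ?s) *\<^sub>R y + ?s *\<^sub>R e) * p y - f y * p y) / ?s \<partial>lborel)"
    proof (rule integral_mono)
      show "integrable lborel (\<lambda>y. (- ?s * (f y * ln (f y / a))) * p y / ?s)"
        using intfl s(1)[of k] by (simp add: mult.assoc)
      show "integrable lborel (\<lambda>y. (f ((1 - ?s) *\<^sub>R y + ?s *\<^sub>R e) * p y - f y * p y) / ?s)"
        using int2 intfp by simp
      fix y
      have "(- ?s * (f y * ln (f y / a))) * p y \<le> (f ((1 - ?s) *\<^sub>R y + ?s *\<^sub>R e) - f y) * p y"
        by (intro mult_right_mono shrink_difference_ge[OF a s(1,3)] p(3))
      then show "(- ?s * (f y * ln (f y / a))) * p y / ?s \<le> (f ((1 - ?s) *\<^sub>R y + ?s *\<^sub>R e) * p y - f y * p y) / ?s"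
        using s(1)[of k] by (intro divide_right_mono) (auto simp: algebra_simps)
    qed
    also have "\<dots> = ((1 / (1 - ?s)) ^ ?n * (\<integral>y. h y \<partial>lborel) - (\<integral>y. f y * p y \<partial>lborel)) / ?s"
      using int2 intfp by (simp add: eq)
    also have "\<dots> = (\<integral>y. ((1 / (1 - ?s)) ^ ?n * h y - f y * p y) / ?s \<partial>lborel)"
      using inth intfp by simp
    also have "\<dots> = (\<integral>y. f y * D k y \<partial>lborel)"
      by (intro Bochner_Integration.integral_cong refl) (simp add: D_def h_def field_simps)
    finally show ?thesis .
  qed
  have "(\<lambda>k. \<integral>y. f y * D k y \<partial>lborel) \<longlonglongrightarrow> (\<integral>y. f y * (frechet_derivative p (at y) (y - e) + ?n * p y) \<partial>lborel)"
  proof (rule integral_dominated_convergence[where w = "\<lambda>y. C * f y"])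
    have [measurable]: "D k \<in> borel_measurable borel" for k unfolding D_def by measurable
    show "(\<lambda>y. f y * D k y) \<in> borel_measurable lborel" for k by simp
    have "(\<lambda>y. frechet_derivative p (at y) (y - e)) \<in> borel_measurable borel"
    proof -
      have "(\<lambda>y. \<Sum>b\<in>Basis. ((y - e) \<bullet> b) * frechet_derivative p (at y) b) \<in> borel_measurable borel"
        by (intro borel_measurable_sum borel_measurable_times borel_measurable_inner borel_measurable_diff
            borel_measurable_const measurable_ident smooth_funs_measurable smooth_funs_partial p(1)) simp
      then show ?thesis unfolding frechet_derivative_sum_Basis[OF p(1), symmetric] .
    qed
    then show "(\<lambda>y. f y * (frechet_derivative p (at y) (y - e) + ?n * p y)) \<in> borel_measurable lborel"
      by (intro borel_measurable_times borel_measurable_add borel_measurable_const) simp_all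
    show "AE y in lborel. (\<lambda>k. f y * D k y) \<longlonglongrightarrow> f y * (frechet_derivative p (at y) (y - e) + ?n * p y)"
      by (intro AE_I2 tendsto_mult tendsto_const Dlim)
    show "AE y in lborel. norm (f y * D k y) \<le> C * f y" for k
      using mult_left_mono[OF DC nonneg]
      by (intro AE_I2) (simp add: abs_mult mult.commute[of C])
    show "integrable lborel (\<lambda>y. C * f y)" using integrable by simp
  qed
  then show ?thesis using ge by (intro LIMSEQ_le_const) auto
qed

end

locale W11_log_concave = integrable_log_concave f for f :: "'a::euclidean_space \<Rightarrow> real" +
  fixes G :: "'a \<Rightarrow> 'a"
  assumes gradient: "has_L1_gradient f G"
begin

lemma integrable_G: "integrable lborel G"
  using gradient unfolding has_L1_gradient_def by blast

lemma measurable_G [measurable]: "G \<in> borel_measurable borel"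
  using borel_measurable_integrable[OF integrable_G] by simp

lemma integrable_inner_affine_bump:
  assumes A: "linear A" and R: "R > 0"
  shows "integrable lborel (\<lambda>y. (G y \<bullet> (v + A y)) * bump R y)"
proof -
  obtain K where K: "\<And>x. norm (A x) \<le> norm x * K"
    using A linear_conv_bounded_linear[of A] bounded_linear.bounded by blast
  have [measurable]: "A \<in> borel_measurable borel"
    using A linear_conv_bounded_linear[of A] by (intro borel_measurable_continuous_onI linear_continuous_on) simp
  have [measurable]: "bump R \<in> borel_measurable (borel :: 'a measure)"
    by (intro smooth_funs_measurable bump_in_smooth_funs)
  show ?thesis
  proof (rule Bochner_Integration.integrable_bound)
    show "integrable lborel (\<lambda>y. (norm v + R * \<bar>K\<bar>) * norm (G y))" using integrable_G by simp
    show "AE y in lborel. norm ((G y \<bullet> (v + A y)) * bump R y) \<le> norm ((norm v + R * \<bar>K\<bar>) * norm (G y))"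
    proof (rule AE_I2)
      fix y
      have "\<bar>G y \<bullet> (v + A y)\<bar> * bump R y \<le> (norm v + R * \<bar>K\<bar>) * norm (G y)"
      proof (cases "norm y < R")
        case True
        have "norm (A y) \<le> norm y * \<bar>K\<bar>" using K[of y] by (meson abs_ge_self mult_left_mono norm_ge_zero order_trans)
        also have "\<dots> \<le> R * \<bar>K\<bar>" using True by (intro mult_right_mono) auto
        finally have "norm (v + A y) \<le> norm v + R * \<bar>K\<bar>" using norm_triangle_ineq[of v "A y"] by linarith
        then have "norm (G y) * norm (v + A y) \<le> norm (G y) * (norm v + R * \<bar>K\<bar>)" by (intro mult_left_mono) auto
        then have "\<bar>G y \<bullet> (v + A y)\<bar> \<le> norm (G y) * (norm v + R * \<bar>K\<bar>)"
          using Cauchy_Schwarz_ineq2[of "G y" "v + A y"] by linarith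
        then have "\<bar>G y \<bullet> (v + A y)\<bar> * bump R y \<le> (norm (G y) * (norm v + R * \<bar>K\<bar>)) * 1"
          using bump_nonneg[of R y] bump_le_1[of R y] R by (intro mult_mono) auto
        then show ?thesis by (simp add: mult.commute)
      next
        case False
        then show ?thesis using R by (simp add: bump_zero)
      qed
      then show "norm ((G y \<bullet> (v + A y)) * bump R y) \<le> norm ((norm v + R * \<bar>K\<bar>) * norm (G y))"
        using R bump_nonneg[of R y] by (simp add: abs_mult)
    qed
  qed measurable
qed

lemma support_inequality_AE:
  assumes a: "0 < a" "a \<le> f e"
  shows "AE y in lborel. G y \<bullet> (e - y) \<ge> - (f y * ln (f y / a))"
proof -
  define F where "F y = G y \<bullet> (e - y) + f y * ln (f y / a)" for y
  have [measurable]: "F \<in> borel_measurable borel" unfolding F_def by measurable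
  have "AE y in lborel. F y \<ge> 0"
  proof (rule AE_nonneg_if_weakly_nonneg)
    fix R :: real assume R: "R > 0"
    have i1: "integrable lborel (\<lambda>y. (G y \<bullet> (e - y)) * bump R y)"
      using integrable_inner_affine_bump[of "\<lambda>y. - y" R e] R linear_uminus by simp
    have i2: "integrable lborel (\<lambda>y. f y * ln (f y / a) * bump R y)"
      by (rule integrable_mult_smooth[OF f_ln_integrable[OF a(1)] bump_in_smooth_funs bump_zero[OF R]])
    show "integrable lborel (\<lambda>y. F y * bump R y)"
      using Bochner_Integration.integrable_add[OF i1 i2] by (simp add: F_def distrib_right)
  next
    fix p :: "'a \<Rightarrow> real" and R
    assume p: "p \<in> smooth_funs" "\<And>x. p x \<ge> 0" "\<And>x. norm x \<ge> R \<Longrightarrow> p x = 0"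
    have "- (\<integral>y. f y * ln (f y / a) * p y \<partial>lborel)
      \<le> (\<integral>y. f y * (frechet_derivative p (at y) (y - e) + DIM('a) * p y) \<partial>lborel)"
      by (rule weak_support_inequality[OF a p(1,3,2)])
    also have "\<dots> = - (\<integral>y. (G y \<bullet> (y - e)) * p y \<partial>lborel)"
      using has_L1_gradient_divergence[where c = e, OF integrable gradient linear_ident p(1,3)] by simp
    also have "\<dots> = (\<integral>y. (G y \<bullet> (e - y)) * p y \<partial>lborel)"
      by (simp add: inner_diff_right flip: Bochner_Integration.integral_minus) (simp add: algebra_simps)
    finally have le: "- (\<integral>y. f y * ln (f y / a) * p y \<partial>lborel) \<le> (\<integral>y. (G y \<bullet> (e - y)) * p y \<partial>lborel)" .
    have i2: "integrable lborel (\<lambda>y. f y * ln (f y / a) * p y)"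
      by (rule integrable_mult_smooth[OF f_ln_integrable[OF a(1)] p(1,3)])
    have i1: "integrable lborel (\<lambda>y. (G y \<bullet> (e - y)) * p y)"
    proof -
      define R' where "R' = max R 0 + 1"
      obtain B where B: "B \<ge> 0" "\<And>x. \<bar>p x\<bar> \<le> B" using smooth_funs_bounded[OF p(1,3)] by blast
      have [measurable]: "p \<in> borel_measurable borel" using p(1) by (rule smooth_funs_measurable)
      show ?thesis
      proof (rule Bochner_Integration.integrable_bound)
        show "integrable lborel (\<lambda>y. ((norm e + R') * B) * norm (G y))" using integrable_G by simp
        show "AE y in lborel. norm ((G y \<bullet> (e - y)) * p y) \<le> norm (((norm e + R') * B) * norm (G y))"
        proof (rule AE_I2)
          fix y
          have "\<bar>G y \<bullet> (e - y)\<bar> * \<bar>p y\<bar> \<le> (norm (G y) * (norm e + R')) * B"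
          proof (cases "norm y < R'")
            case True
            have "norm (e - y) \<le> norm e + R'" using norm_triangle_ineq4[of e y] True by linarith
            then have "norm (G y) * norm (e - y) \<le> norm (G y) * (norm e + R')" by (intro mult_left_mono) auto
            then have "\<bar>G y \<bullet> (e - y)\<bar> \<le> norm (G y) * (norm e + R')"
              using Cauchy_Schwarz_ineq2[of "G y" "e - y"] by linarith
            then show ?thesis by (intro mult_mono B) auto
          next
            case False
            then have "norm y \<ge> R" unfolding R'_def by linarith
            then show ?thesis using p(3) B by (simp add: R'_def)
          qed
          then show "norm ((G y \<bullet> (e - y)) * p y) \<le> norm (((norm e + R') * B) * norm (G y))"
            using B by (simp add: abs_mult R'_def mult_ac)
        qed
      qed measurable
    qed
    show "(\<integral>y. F y * p y \<partial>lborel) \<ge> 0"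
      using le i1 i2 by (simp add: F_def distrib_right)
  qed measurable
  then show ?thesis by eventually_elim (simp add: F_def)
qed

text \<open>The field \<open>y \<mapsto> A (y - c)\<close> has the constant divergence \<open>\<Sum>\<^sub>b A b \<bullet> b\<close>, the trace of \<open>A\<close>. Cutting it off by a wide bump
function adds the derivative of the bump in a direction of size comparable to the radius, which stays
bounded and tends to 0 pointwise.\<close>

lemma integral_divergence_bump_tendsto:
  assumes A: "linear A"
  shows "(\<lambda>k. \<integral>y. (G y \<bullet> A (y - c)) * bump (real (Suc k)) y \<partial>lborel)
    \<longlonglongrightarrow> - ((\<Sum>b\<in>Basis. A b \<bullet> b) * (\<integral>y. f y \<partial>lborel))"
proof -
  let ?t = "\<Sum>b\<in>Basis. A b \<bullet> b"
  let ?d = "\<lambda>k y. frechet_derivative (bump (real (Suc k))) (at y) (A (y - c))"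
  obtain K where K: "\<And>x. norm (A x) \<le> norm x * K" "K > 0"
    using A linear_conv_bounded_linear[of A] bounded_linear.pos_bounded by blast
  obtain C where "\<forall>R>0. \<forall>(x::'a) h. \<bar>frechet_derivative (bump R) (at x) h\<bar> \<le> C * norm h / R"
    using bump_derivative_bound by blast
  then have C: "\<bar>frechet_derivative (bump R) (at x) h\<bar> \<le> C * norm h / R" if "R > 0" for R h and x :: 'a
    using that by blast
  have C0: "C \<ge> 0"
  proof -
    obtain b :: 'a where "b \<in> Basis" using nonempty_Basis by blast
    then show ?thesis using C[of 1 0 b] by simp
  qed
  have dbound: "\<bar>?d k y\<bar> \<le> C * K * norm (y - c) / real (Suc k)" for k y
  proof -
    have "\<bar>?d k y\<bar> \<le> C * norm (A (y - c)) / real (Suc k)" by (rule C) simp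
    also have "\<dots> \<le> C * (norm (y - c) * K) / real (Suc k)"
      using C0 K by (intro divide_right_mono mult_left_mono) auto
    finally show ?thesis by (simp add: mult_ac)
  qed
  have dbound2: "\<bar>?d k y\<bar> \<le> C * K * (1 + norm c)" for k y
  proof (cases "norm y \<le> real (Suc k)")
    case True
    have "norm c \<le> real (Suc k) * norm c" by (simp add: mult_le_cancel_right1)
    then have "norm (y - c) \<le> real (Suc k) * (1 + norm c)"
      using norm_triangle_ineq4[of y c] True unfolding distrib_left mult_1_right by linarith
    then have "C * K * norm (y - c) \<le> C * K * (real (Suc k) * (1 + norm c))"
      using C0 K by (intro mult_left_mono) auto
    then have "C * K * norm (y - c) / real (Suc k) \<le> C * K * (1 + norm c)"
      by (simp add: pos_divide_le_eq mult_ac)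
    then show ?thesis using dbound[of k y] by linarith
  next
    case False
    have "?d k y = 0"
      by (rule smooth_funs_partial_outside[OF bump_in_smooth_funs bump_zero]) (use False in auto)
    then show ?thesis using C0 K by simp
  qed
  have "(\<lambda>k. \<integral>y. f y * (?d k y + ?t * bump (real (Suc k)) y) \<partial>lborel) \<longlonglongrightarrow> (\<integral>y. f y * (0 + ?t * 1) \<partial>lborel)"
  proof (rule integral_dominated_convergence[where w = "\<lambda>y. (C * K * (1 + norm c) + \<bar>?t\<bar>) * f y"])
    show "(\<lambda>y. f y * (?d k y + ?t * bump (real (Suc k)) y)) \<in> borel_measurable lborel" for k
    proof -
      have "(\<lambda>y. f y * (?d k y + ?t * bump (real (Suc k)) y)) = (\<lambda>y. f y * (- (2 * exp 1 / (real (Suc k))\<^sup>2) * flat_exp 2 (1 - (y \<bullet> y) / (real (Suc k))\<^sup>2) * (y \<bullet> A (y - c)) + ?t * bump (real (Suc k)) y))"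
        by (simp add: bump_derivative)
      moreover have [measurable]: "bump (real (Suc k)) \<in> borel_measurable (borel :: 'a measure)"
        by (intro smooth_funs_measurable bump_in_smooth_funs)
      moreover have [measurable]: "A \<in> borel_measurable borel"
        using A linear_conv_bounded_linear[of A] by (intro borel_measurable_continuous_onI linear_continuous_on) simp
      moreover have [measurable]: "flat_exp 2 \<in> borel_measurable borel"
        using flat_exp_deriv[of 2] by (intro borel_measurable_continuous_onI continuous_at_imp_continuous_on) (auto intro: DERIV_isCont)
      ultimately show ?thesis by simp
    qed
    show "AE y in lborel. (\<lambda>k. f y * (?d k y + ?t * bump (real (Suc k)) y)) \<longlonglongrightarrow> f y * (0 + ?t * 1)"
    proof (intro AE_I2 tendsto_mult tendsto_add tendsto_const)
      fix y :: 'a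
      show "(\<lambda>k. ?d k y) \<longlonglongrightarrow> 0"
      proof (rule Lim_null_comparison)
        show "\<forall>\<^sub>F k in sequentially. norm (?d k y) \<le> C * K * norm (y - c) * (1 / real (Suc k))"
          using dbound[of _ y] by simp
        show "(\<lambda>k. C * K * norm (y - c) * (1 / real (Suc k))) \<longlonglongrightarrow> 0"
          by (intro tendsto_mult_right_zero LIMSEQ_Suc[OF lim_1_over_n])
      qed
      show "(\<lambda>k. bump (real (Suc k)) y) \<longlonglongrightarrow> 1"
        by (rule filterlim_compose[OF bump_tendsto_1])
          (intro filterlim_compose[OF filterlim_real_sequentially filterlim_Suc])
    qed
    show "AE y in lborel. norm (f y * (?d k y + ?t * bump (real (Suc k)) y)) \<le> (C * K * (1 + norm c) + \<bar>?t\<bar>) * f y" for k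
    proof (rule AE_I2)
      fix y :: 'a
      have "\<bar>?t * bump (real (Suc k)) y\<bar> \<le> \<bar>?t\<bar> * 1"
        unfolding abs_mult using bump_nonneg[of "real (Suc k)" y] bump_le_1[of "real (Suc k)" y]
        by (intro mult_left_mono) auto
      then have "\<bar>?d k y + ?t * bump (real (Suc k)) y\<bar> \<le> C * K * (1 + norm c) + \<bar>?t\<bar>"
        using dbound2[of k y] by linarith
      then have "f y * \<bar>?d k y + ?t * bump (real (Suc k)) y\<bar> \<le> f y * (C * K * (1 + norm c) + \<bar>?t\<bar>)"
        by (intro mult_left_mono) auto
      then show "norm (f y * (?d k y + ?t * bump (real (Suc k)) y)) \<le> (C * K * (1 + norm c) + \<bar>?t\<bar>) * f y"
        by (simp add: abs_mult mult.commute)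
    qed
  qed (use integrable in auto)
  moreover have "(\<integral>y. f y * (?d k y + ?t * bump (real (Suc k)) y) \<partial>lborel) = - (\<integral>y. (G y \<bullet> A (y - c)) * bump (real (Suc k)) y \<partial>lborel)" for k
    by (rule has_L1_gradient_divergence[OF integrable gradient A bump_in_smooth_funs bump_zero]) auto
  ultimately have "(\<lambda>k. - (\<integral>y. (G y \<bullet> A (y - c)) * bump (real (Suc k)) y \<partial>lborel)) \<longlonglongrightarrow> ?t * (\<integral>y. f y \<partial>lborel)"
    by (simp add: mult.commute)
  from tendsto_minus[OF this] show ?thesis by simp
qed

text \<open>If the derivative in direction \<open>w\<close> vanished, the field \<open>y \<mapsto> (y \<bullet> w) w\<close>, which is parallel to \<open>w\<close> and has
divergence \<open>\<bar>w\<bar>\<^sup>2\<close>, would force \<open>\<integral>f = 0\<close>.\<close>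

lemma directional_gradient_pos:
  assumes "w \<noteq> 0"
  shows "(\<integral>y. \<bar>G y \<bullet> w\<bar> \<partial>lborel) > 0"
proof (rule ccontr)
  assume "\<not> ?thesis"
  moreover have int: "integrable lborel (\<lambda>y. \<bar>G y \<bullet> w\<bar>)"
    using integrable_G by (intro integrable_abs integrable_inner_left)
  moreover have "(\<integral>y. \<bar>G y \<bullet> w\<bar> \<partial>lborel) \<ge> 0" by simp
  ultimately have "(\<integral>y. \<bar>G y \<bullet> w\<bar> \<partial>lborel) = 0" by linarith
  then have ae: "AE y in lborel. G y \<bullet> w = 0"
    using integral_nonneg_eq_0_iff_AE[OF int] by simp
  define A where "A y = (y \<bullet> w) *\<^sub>R w" for y :: 'a
  have A: "linear A" unfolding A_def by (intro linearI) (auto simp: inner_add_left scaleR_add_left)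
  have tr: "(\<Sum>b\<in>Basis. A b \<bullet> b) = w \<bullet> w"
    unfolding A_def by (subst (3) euclidean_inner) (simp add: inner_commute)
  have "(\<integral>y. (G y \<bullet> A (y - 0)) * bump (real (Suc k)) y \<partial>lborel) = 0" for k
    by (rule integral_eq_zero_AE) (use ae in \<open>eventually_elim, simp add: A_def\<close>)
  with integral_divergence_bump_tendsto[OF A, of 0]
  have "(\<lambda>k::nat. 0::real) \<longlonglongrightarrow> - ((w \<bullet> w) * (\<integral>y. f y \<partial>lborel))" unfolding tr by simp
  then have "(w \<bullet> w) * (\<integral>y. f y \<partial>lborel) = 0" by (simp add: LIMSEQ_const_iff)
  with assms integral_pos show False by simp
qed

text \<open>The pointwise inequality holds almost everywhere simultaneously for a countable dense set of points of the
ellipsoid, hence for all of them by continuity. The point at which the left-hand side is smallest produces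
the norm. Since \<open>G y \<bullet> (y - c)\<close> is not known to be integrable, the inequality is multiplied by a bump
function before it is integrated.\<close>

lemma gradient_integral_le:
  fixes T :: "'a \<Rightarrow> 'a"
  assumes T: "linear T" and a: "0 < a" "\<And>w. norm w \<le> 1 \<Longrightarrow> a \<le> f (c + T w)"
  shows "(\<integral>y. norm (adjoint T (G y)) \<partial>lborel)
    \<le> DIM('a) * (\<integral>y. f y \<partial>lborel) + (\<integral>y. f y * ln (f y / a) \<partial>lborel)"
proof -
  define H where "H y = adjoint T (G y)" for y
  have blH: "bounded_linear (adjoint T)"
    using adjoint_linear[OF T] by (simp add: linear_conv_bounded_linear)
  have intH: "integrable lborel (\<lambda>y. norm (H y))"
    unfolding H_def by (intro integrable_norm integrable_bounded_linear[OF blH] integrable_G)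
  have inner: "G y \<bullet> T w = H y \<bullet> w" for y w
    unfolding H_def using T by (simp add: adjoint_clauses)
  obtain D :: "'a set" where D: "countable D" "D \<subseteq> cball 0 1" "cball 0 1 \<subseteq> closure D"
    using separable by blast
  have "AE y in lborel. \<forall>w\<in>D. G y \<bullet> (c + T w - y) \<ge> - (f y * ln (f y / a))"
    using D a by (subst AE_ball_countable) (auto intro!: support_inequality_AE)
  then have key: "AE y in lborel. norm (H y) \<le> f y * ln (f y / a) + G y \<bullet> (c - y)"
  proof eventually_elim
    case (elim y)
    let ?S = "{w. G y \<bullet> (c + T w - y) \<ge> - (f y * ln (f y / a))}"
    have "continuous_on UNIV (\<lambda>w. G y \<bullet> (c + T w - y))"
      using T linear_conv_bounded_linear[of T] by (intro continuous_intros linear_continuous_on) auto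
    then have "closed ?S" by (intro closed_Collect_le continuous_on_const)
    moreover have "D \<subseteq> ?S" using elim by auto
    ultimately have "closure D \<subseteq> ?S" by (rule closure_minimal[rotated])
    with D(3) have S: "cball 0 1 \<subseteq> ?S" by blast
    \<comment> \<open>For \<open>H y = 0\<close> the division by 0 makes this the zero vector, which is just as good.\<close>
    define w where "w = - (1 / norm (H y)) *\<^sub>R H y"
    have "w \<in> cball 0 1" unfolding w_def by simp
    with S have "G y \<bullet> (c + T w - y) \<ge> - (f y * ln (f y / a))" by blast
    moreover have "G y \<bullet> (c + T w - y) = H y \<bullet> w + G y \<bullet> (c - y)"
      by (simp add: inner_add_right inner_diff_right inner)
    moreover have "H y \<bullet> w = - norm (H y)"
      by (cases "H y = 0") (auto simp: w_def power2_norm_eq_inner[symmetric] power2_eq_square)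
    ultimately show ?case by linarith
  qed
  let ?b = "\<lambda>k. bump (real (Suc k)) :: 'a \<Rightarrow> real"
  have bm [measurable]: "?b k \<in> borel_measurable borel" for k
    by (intro smooth_funs_measurable bump_in_smooth_funs)
  have blim: "(\<lambda>k. ?b k y) \<longlonglongrightarrow> 1" for y
    by (rule filterlim_compose[OF bump_tendsto_1])
      (intro filterlim_compose[OF filterlim_real_sequentially filterlim_Suc])
  have lim: "(\<lambda>k. \<integral>y. g y * ?b k y \<partial>lborel) \<longlonglongrightarrow> (\<integral>y. g y \<partial>lborel)"
    and bint: "integrable lborel (\<lambda>y. g y * ?b k y)" if g: "integrable lborel g" for g :: "'a \<Rightarrow> real" and k
  proof -
    have [measurable]: "g \<in> borel_measurable borel" using borel_measurable_integrable[OF g] by simp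
    have "(\<lambda>k. \<integral>y. g y * ?b k y \<partial>lborel) \<longlonglongrightarrow> (\<integral>y. g y * 1 \<partial>lborel)"
    proof (rule integral_dominated_convergence[where w = "\<lambda>y. \<bar>g y\<bar>"])
      show "AE y in lborel. (\<lambda>k. g y * ?b k y) \<longlonglongrightarrow> g y * 1"
        by (intro AE_I2 tendsto_mult tendsto_const blim)
      show "AE y in lborel. norm (g y * ?b k y) \<le> \<bar>g y\<bar>" for k
        unfolding real_norm_def abs_mult
        by (intro AE_I2 mult_left_le) (auto simp: bump_nonneg bump_le_1)
      show "(\<lambda>y. g y * ?b k y) \<in> borel_measurable lborel" for k by measurable
    qed (use g in simp_all)
    then show "(\<lambda>k. \<integral>y. g y * ?b k y \<partial>lborel) \<longlonglongrightarrow> (\<integral>y. g y \<partial>lborel)" by simp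
    show "integrable lborel (\<lambda>y. g y * ?b k y)"
      by (rule integrable_mult_smooth[OF g bump_in_smooth_funs bump_zero]) auto
  qed
  have le: "(\<integral>y. norm (H y) * ?b k y \<partial>lborel)
    \<le> (\<integral>y. f y * ln (f y / a) * ?b k y \<partial>lborel) - (\<integral>y. (G y \<bullet> (y - c)) * ?b k y \<partial>lborel)" for k
  proof -
    have i1: "integrable lborel (\<lambda>y. (G y \<bullet> (y - c)) * ?b k y)"
      using integrable_inner_affine_bump[OF linear_ident, of "real (Suc k)" "- c"] by simp
    have i2: "integrable lborel (\<lambda>y. f y * ln (f y / a) * ?b k y)" by (rule bint[OF f_ln_integrable[OF a(1)]])
    have "(\<integral>y. norm (H y) * ?b k y \<partial>lborel)
      \<le> (\<integral>y. f y * ln (f y / a) * ?b k y - (G y \<bullet> (y - c)) * ?b k y \<partial>lborel)"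
    proof (rule integral_mono_AE)
      show "AE y in lborel. norm (H y) * ?b k y \<le> f y * ln (f y / a) * ?b k y - (G y \<bullet> (y - c)) * ?b k y"
        using key
      proof eventually_elim
        case (elim y)
        then have "norm (H y) * ?b k y \<le> (f y * ln (f y / a) + G y \<bullet> (c - y)) * ?b k y"
          by (intro mult_right_mono bump_nonneg)
        then show ?case by (simp add: algebra_simps inner_diff_right)
      qed
    qed (intro bint intH Bochner_Integration.integrable_diff i1 i2)+
    then show ?thesis using i1 i2 by simp
  qed
  have "(\<lambda>k. (\<integral>y. f y * ln (f y / a) * ?b k y \<partial>lborel) - (\<integral>y. (G y \<bullet> (y - c)) * ?b k y \<partial>lborel))
    \<longlonglongrightarrow> (\<integral>y. f y * ln (f y / a) \<partial>lborel) - (- ((\<Sum>b\<in>(Basis::'a set). b \<bullet> b) * (\<integral>y. f y \<partial>lborel)))"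
    by (intro tendsto_diff lim f_ln_integrable a integral_divergence_bump_tendsto[OF linear_ident])
  then have "(\<integral>y. norm (H y) \<partial>lborel) \<le> (\<integral>y. f y * ln (f y / a) \<partial>lborel) - (- ((\<Sum>b\<in>(Basis::'a set). b \<bullet> b) * (\<integral>y. f y \<partial>lborel)))"
    using lim[OF intH] le by (intro LIMSEQ_le) auto
  then show ?thesis by (simp add: H_def)
qed

end

section \<open>The main inequality\<close>

text \<open>Here \<open>k\<close> is the volume of the gauge ball, \<open>v\<close> the volume factor of the ellipsoid, \<open>V\<close> and \<open>W\<close> the volumes of
the unit balls in dimensions \<open>n\<close> and \<open>n - 1\<close>, and \<open>n * Y = \<integral>f ln (f / M)\<close>.
The bound for \<open>h\<close> has the form \<open>n I (1 + x)\<close> and is relaxed to \<open>n I exp x\<close>, which produces the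
exponential factor of the theorem.\<close>

lemma combine_estimates:
  fixes n I P M a v V W k h Y :: real
  assumes pos: "n > 1" "I > 0" "P > 0" "M > 0" "a > 0" "v > 0" "V > 0" "W > 0" "k \<ge> 0"
    and vol: "V powr (1 / n) * (n * V) \<le> k powr (1 / n) * (2 * W * h)"
    and h: "h \<le> n * I + (n * Y + ln (M / a) * I)"
  shows "1 / (exp (Y / I) * M powr (1 / n) * (I / P) powr ((n - 1) / n) * (I / (a * v * V)) powr (1 / n))
    \<le> P powr ((n - 1) / n) * (v * k) powr (1 / n) / (V / (2 * W))"
proof -
  define E where "E = exp (Y / I)"
  define m where "m = M powr (1 / n)"
  define \<alpha> where "\<alpha> = a powr (1 / n)"
  define K where "K = k powr (1 / n)"
  define \<nu> where "\<nu> = v powr (1 / n)"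
  define \<omega> where "\<omega> = V powr (1 / n)"
  define Q where "Q = P powr ((n - 1) / n)"
  have p: "E > 0" "m > 0" "\<alpha> > 0" "K \<ge> 0" "\<nu> > 0" "\<omega> > 0" "Q > 0"
    using pos by (auto simp: E_def m_def \<alpha>_def K_def \<nu>_def \<omega>_def Q_def)
  have "n * I * (1 + (Y / I + ln (M / a) / n)) = n * I + (n * Y + ln (M / a) * I)"
    using pos by (simp add: field_simps)
  with h have "h \<le> n * I * (1 + (Y / I + ln (M / a) / n))" by (simp only:)
  also have "\<dots> \<le> n * I * exp (Y / I + ln (M / a) / n)"
    using pos by (intro mult_left_mono exp_ge_add_one_self) auto
  also have "exp (Y / I + ln (M / a) / n) = E * (M / a) powr (1 / n)"
    using pos by (simp add: E_def exp_add powr_def)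
  also have "(M / a) powr (1 / n) = m / \<alpha>" using pos by (simp add: m_def \<alpha>_def powr_divide)
  finally have hle: "h \<le> n * I * (E * (m / \<alpha>))" .
  have "\<omega> * (n * V) \<le> K * (2 * W * h)" using vol by (simp add: \<omega>_def K_def)
  also have "\<dots> \<le> K * (2 * W * (n * I * (E * (m / \<alpha>))))"
    using hle p pos by (intro mult_left_mono) auto
  finally have "n * (\<omega> * V * \<alpha>) \<le> n * (K * (2 * W * (I * (E * m))))"
    using p by (simp add: field_simps)
  then have key: "\<omega> * V * \<alpha> \<le> K * (2 * W * (I * (E * m)))" using pos by (simp only: mult_le_cancel_left_pos)
  have "(I / P) powr ((n - 1) / n) * (I / (a * v * V)) powr (1 / n)
    = (I powr ((n - 1) / n) * I powr (1 / n)) / (Q * (\<alpha> * \<nu> * \<omega>))"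
    using pos by (simp add: powr_divide powr_mult Q_def \<alpha>_def \<nu>_def \<omega>_def)
  also have "I powr ((n - 1) / n) * I powr (1 / n) = I"
    using pos by (simp add: diff_divide_distrib flip: powr_add)
  finally have e: "exp (Y / I) * M powr (1 / n) * (I / P) powr ((n - 1) / n) * (I / (a * v * V)) powr (1 / n)
    = E * m * (I / (Q * (\<alpha> * \<nu> * \<omega>)))" by (simp add: E_def m_def mult.assoc)
  have "1 / (E * m * (I / (Q * (\<alpha> * \<nu> * \<omega>)))) = Q * \<nu> * ((\<omega> * V * \<alpha>) / (V * (I * (E * m))))"
    using p pos by (simp add: field_simps)
  also have "\<dots> \<le> Q * \<nu> * ((K * (2 * W * (I * (E * m)))) / (V * (I * (E * m))))"
    using p pos key by (intro mult_left_mono divide_right_mono) auto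
  also have "\<dots> = Q * (v * k) powr (1 / n) / (V / (2 * W))"
    using p pos by (simp add: powr_mult \<nu>_def[symmetric] K_def[symmetric])
  finally show ?thesis unfolding e Q_def .
qed

theorem theorem1p3:
  fixes f :: "real ^ 'n \<Rightarrow> real"
  assumes "CARD('n) \<ge> 2"
    and "f \<in> W11"
    and "log_concave f"
    and "upper_semicontinuous f"
    and "(\<integral>x. f x \<partial>lborel) > 0"
  shows "let n = real CARD('n) in
    Lp_norm (n / (n - 1)) f * measure lborel (polar_projection_body f) powr (1 / n)
      / (unit_ball_vol n / (2 * unit_ball_vol (n - 1)))
    \<ge> 1 / (exp ((\<integral>x. f x * ln ((f x / sup_norm f) powr (1 / n)) \<partial>lborel) / (\<integral>x. f x \<partial>lborel))
            * sup_norm f powr (1 / n)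
            * ((\<integral>x. f x \<partial>lborel) / (\<integral>x. f x powr (n / (n - 1)) \<partial>lborel)) powr ((n - 1) / n)
            * integral_ratio f)"
proof -
  have ilc: "integrable_log_concave f"
    using assms(2-5) by (simp add: integrable_log_concave_def W11_def)
  interpret integrable_log_concave f by (rule ilc)
  interpret W11_log_concave f "gradient f"
  proof
    have "\<exists>G. has_L1_gradient f G" using assms(2) by (simp add: W11_def)
    then show "has_L1_gradient f (gradient f)" unfolding gradient_def by (rule someI_ex)
  qed
  define n where "n = real CARD('n)"
  define I where "I = (\<integral>x. f x \<partial>lborel)"
  define M where "M = sup_norm f"
  define P where "P = (\<integral>x. f x powr (n / (n - 1)) \<partial>lborel)"
  define Y where "Y = (\<integral>x. f x * ln ((f x / sup_norm f) powr (1 / n)) \<partial>lborel)"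
  define V where "V = unit_ball_vol n"
  define W where "W = unit_ball_vol (n - 1)"
  have n: "n \<ge> 2" "n > 1" using assms(1) by (auto simp: n_def)
  have I: "I > 0" and M: "M > 0" using assms(5) sup_norm_pos by (auto simp: I_def M_def)
  have V: "V > 0" "W > 0" using n by (auto simp: V_def W_def)
  have john: "ellipsoid_fun (john_ellipsoid f)" "\<And>x. john_ellipsoid f x \<le> f x"
    using john_ellipsoid_is_arg_max[OF ilc] by (auto simp: is_arg_max_def)
  obtain a c and A :: "real^'n^'n" where a: "a > 0" and A: "bij ((*v) A)"
    and jeq: "john_ellipsoid f = (\<lambda>x. a * indicator (ellipsoid_at c A) x)"
    using john(1) unfolding ellipsoid_fun_def ellipsoid_iff by blast
  have af: "a \<le> f (c + A *v w)" if "norm w \<le> 1" for w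
  proof -
    have "c + A *v w \<in> ellipsoid_at c A" using that unfolding ellipsoid_at_def by (intro imageI) simp
    then show ?thesis using john(2)[of "c + A *v w"] by (simp add: jeq)
  qed
  define v where "v = vol_factor A"
  have v: "v > 0" unfolding v_def vol_factor_pos_iff by (rule A)
  have J: "(\<integral>x. john_ellipsoid f x \<partial>lborel) = a * v * V"
    unfolding jeq using integral_ellipsoid_fun[OF a, of c A]
    by (simp add: measure_ellipsoid_at v_def V_def n_def)
  define H where "H y = adjoint ((*v) A) (gradient f y)" for y
  have inner: "H y \<bullet> w = gradient f y \<bullet> (A *v w)" for y w
    unfolding H_def by (simp add: adjoint_clauses)
  have H: "integrable lborel H"
    unfolding H_def
    by (intro integrable_bounded_linear[OF _ integrable_G])
      (simp add: adjoint_linear linear_conv_bounded_linear[symmetric])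
  have Hpos: "(\<integral>y. \<bar>H y \<bullet> w\<bar> \<partial>lborel) > 0" if "w \<noteq> 0" for w
    unfolding inner
  proof (rule directional_gradient_pos)
    show "A *v w \<noteq> 0" using that A by (metis bij_pointE matrix_vector_mult_0_right)
  qed
  define K where "K = {w. (\<integral>y. \<bar>H y \<bullet> w\<bar> \<partial>lborel) \<le> 1}"
  have K: "compact K"
    using measure_polar_ball_ge(1,2)[OF H Hpos] by (simp add: K_def compact_eq_bounded_closed)
  have "polar_projection_body f = (*v) A ` K"
  proof (intro equalityI subsetI)
    fix x assume x: "x \<in> polar_projection_body f"
    obtain w where w: "x = A *v w" using A by (metis bij_pointE)
    then show "x \<in> (*v) A ` K"
      using x by (auto simp: polar_projection_body_def polar_projection_norm_def K_def inner)
  qed (auto simp: polar_projection_body_def polar_projection_norm_def K_def inner)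
  then have body: "measure lborel (polar_projection_body f) = v * measure lborel K"
    using measure_matrix_image[OF K, of A] by (simp add: v_def)
  define h where "h = (\<integral>y. norm (H y) \<partial>lborel)"
  have vol: "V powr (1 / n) * (n * V) \<le> measure lborel K powr (1 / n) * (2 * W * h)"
    using measure_polar_ball_ge(3)[OF H Hpos] by (simp add: K_def V_def W_def n_def h_def)
  have hle: "h \<le> n * I + (\<integral>y. f y * ln (f y / a) \<partial>lborel)"
    using gradient_integral_le[of "(*v) A" a c] a af unfolding h_def H_def I_def n_def by simp
  \<comment> \<open>The logarithm of a power is a multiple of the logarithm even at 0, where both sides are 0.\<close>
  have Yeq: "n * Y = (\<integral>x. f x * ln (f x / M) \<partial>lborel)"
  proof -
    have "f x * ln ((f x / M) powr (1 / n)) = (f x * ln (f x / M)) / n" for x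
      by (simp add: ln_powr)
    then show ?thesis unfolding Y_def M_def[symmetric] using n by simp
  qed
  have ln_split: "f x * ln (f x / a) = f x * ln (f x / M) + ln (M / a) * f x" for x
    using nonneg[of x] M a by (cases "f x = 0") (auto simp: ln_div algebra_simps)
  have lna: "(\<integral>y. f y * ln (f y / a) \<partial>lborel) = n * Y + ln (M / a) * I"
    unfolding ln_split Yeq I_def using f_ln_integrable[OF M] integrable by simp
  \<comment> \<open>The integral is finite because \<open>f\<close> is bounded and integrable, so it can vanish only if \<open>f\<close> does.\<close>
  have P: "P > 0"
  proof -
    define q where "q = n / (n - 1)"
    have q: "q > 1" using n by (simp add: q_def)
    have int: "integrable lborel (\<lambda>x. f x powr q)"
    proof (rule Bochner_Integration.integrable_bound)
      show "integrable lborel (\<lambda>x. M powr (q - 1) * f x)" using integrable by simp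
      have "f x powr q \<le> M powr (q - 1) * f x" for x
      proof -
        have "f x powr q = f x powr (q - 1) * f x powr 1"
          by (simp only: powr_add[symmetric]) simp
        also have "\<dots> \<le> M powr (q - 1) * f x"
          using q le_sup_norm[of x] by (intro mult_mono powr_mono2) (auto simp: M_def)
        finally show ?thesis .
      qed
      then show "AE x in lborel. norm (f x powr q) \<le> norm (M powr (q - 1) * f x)"
        by (intro AE_I2) simp
    qed measurable
    have "P \<noteq> 0"
    proof
      assume "P = 0"
      then have "AE x in lborel. f x powr q = 0"
        using integral_nonneg_eq_0_iff_AE[OF int] by (simp add: P_def q_def)
      then have "(\<integral>x. f x \<partial>lborel) = 0" by (intro integral_eq_zero_AE) simp
      then show False using assms(5) by simp
    qed
    moreover have "P \<ge> 0" unfolding P_def by simp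
    ultimately show ?thesis by simp
  qed
  have Lp: "Lp_norm (n / (n - 1)) f = P powr ((n - 1) / n)"
    by (simp add: Lp_norm_def P_def)
  have ir: "integral_ratio f = (I / (a * v * V)) powr (1 / n)"
    by (simp add: integral_ratio_def I_def J n_def)
  show ?thesis
    unfolding Let_def n_def[symmetric] Lp body ir
    unfolding I_def[symmetric] P_def[symmetric] Y_def[symmetric] V_def[symmetric] W_def[symmetric]
    unfolding M_def[symmetric]
    using combine_estimates[OF n(2) I P M a v V _ vol hle[unfolded lna]] by simp
qed

end
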